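(* The set of maps $f\in C_\lambda(I)$ that are locally eventually onto, satisfy $\lambda(\mathrm{Per}(f))=1$, and satisfy $\lambda(\mathrm{Per}(f,k))>0$ for every $k\ge1$, is dense in $C_\lambda(I)$.
   Context: $I=[0,1]$, $\lambda$ is Lebesgue measure. $C_\lambda(I)$ is the set of continuous maps $f\colon I\to I$ preserving $\lambda$ (i.e. $\lambda(f^{-1}(A))=\lambda(A)$ for every Borel $A\subset I$), with the uniform metric $\rho(f,g)=\sup_{x\in I}|f(x)-g(x)|$. A map $f$ is locally eventually onto (leo) if for every nonempty open interval $J\subset I$ there is $n\ge0$ with $f^n(J)=I$. $\mathrm{Per}(f,k)=\{x: f^k(x)=x,\ f^i(x)\ne x \text{ for } 1\le i<k\}$ and $\mathrm{Per}(f)=\bigcup_{k\ge1}\mathrm{Per}(f,k)$. *)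

theory Defs
  imports "HOL-Analysis.Analysis"
begin

text \<open>The unit interval I = [0,1]; maps on I are modelled as functions real \<Rightarrow> real
whose behaviour outside I is irrelevant.\<close>

abbreviation unitI :: "real set" where "unitI \<equiv> {0..1}"

definition C_lambda :: "(real \<Rightarrow> real) set" where
  "C_lambda = {f. continuous_on unitI f \<and> f ` unitI \<subseteq> unitI \<and>
     (\<forall>A \<in> sets borel. A \<subseteq> unitI \<longrightarrow>
        emeasure lborel {x \<in> unitI. f x \<in> A} = emeasure lborel A)}"

definition unif_dist :: "(real \<Rightarrow> real) \<Rightarrow> (real \<Rightarrow> real) \<Rightarrow> real" where
  "unif_dist f g = (SUP x \<in> unitI. \<bar>f x - g x\<bar>)"

definition leo :: "(real \<Rightarrow> real) \<Rightarrow> bool" where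
  "leo f \<longleftrightarrow> (\<forall>a b. 0 \<le> a \<longrightarrow> a < b \<longrightarrow> b \<le> 1 \<longrightarrow>
       (\<exists>n. (f ^^ n) ` {a<..<b} = unitI))"

definition Per_k :: "(real \<Rightarrow> real) \<Rightarrow> nat \<Rightarrow> real set" where
  "Per_k f k = {x \<in> unitI. (f ^^ k) x = x \<and> (\<forall>i. 1 \<le> i \<and> i < k \<longrightarrow> (f ^^ i) x \<noteq> x)}"

definition Per :: "(real \<Rightarrow> real) \<Rightarrow> real set" where
  "Per f = (\<Union>k \<in> {1..}. Per_k f k)"

end

theory Submission
  imports Defs "HOL-Probability.Probability" "HOL-Combinatorics.Cycles"
begin

text \<open>Cut the interval into \<open>N = 3 ^ M\<close> blocks and follow \<open>f\<close> by a lattice walk on the grid of mesh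
\<open>1 / N\<close>, replacing every unit step by a scaled copy of a coordinate function of Peano's curve. The
resulting map \<open>g\<close> carries triadic cells of level \<open>2 * n + 1\<close> onto cells of level \<open>n\<close>, in each third of a
cell independently. Iterating, every cell spreads over the whole interval, because \<open>f\<close> preserves length and
the walk leaves some slack: \<open>g\<close> is locally eventually onto. The choice among the thirds at each
scale produces, for every admissible itinerary, an uncountable set of periodic points carrying a nonatomic
invariant measure. Ranking the values of \<open>f\<close> at the grid points gives a permutation of the blocks close to
\<open>f\<close>, whose cycles yield such a measure giving each block mass \<open>1 / N\<close>. Mixing in
small multiples of countably many others gives an invariant nonatomic measure of full support, concentrated
on periodic points and close to Lebesgue measure; conjugating \<open>g\<close> by its distribution function gives the
required map.\<close>

section \<open>Triadic cells\<close>

text \<open>An expanding map with finitely many monotone pieces has only countably many periodic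
  points, so the usual piecewise linear approximants cannot give periodic points full measure; here
  the map folds at every scale. The levels \<open>2 * n + 1\<close> and \<open>n\<close> come from
  two counts. Peano's coordinate cuts its domain into 9 parts and its range into 3, so two triadic
  levels of the domain pay for one of the range. The extra 1 gives each of the \<open>3 ^ M\<close>
  blocks \<open>3 ^ (M + 1)\<close> unit steps, enough to sweep any lattice interval inside
  \<open>{0..3 ^ M}\<close> three times, and hence to realize every wanted transition between
  blocks. Preservation of length is not asked of \<open>g\<close>; only the final change of variable
  creates it. For \<open>f\<close> it acts as a counting bound: a run of blocks cannot have too
  short an image, and ranking displaces a block only slightly. The second fact keeps the change of
  variable close to the identity, as it provides an invariant measure of \<open>g\<close> that gives
  each block its correct mass.\<close>

definition cell :: "nat \<Rightarrow> nat \<Rightarrow> real set" where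
  "cell n i = {real i / 3 ^ n .. (real i + 1) / 3 ^ n}"

text \<open>Triadic ancestry: the last \<open>m - n\<close> ternary digits of the index are dropped.
  Arithmetic on indices takes the place of inclusions between intervals, which
  \<open>desc_cell\<close> recovers.\<close>

definition desc :: "nat \<Rightarrow> nat \<Rightarrow> nat \<Rightarrow> nat \<Rightarrow> bool" where
  "desc m i n j \<longleftrightarrow> n \<le> m \<and> i div 3 ^ (m - n) = j"

lemma desc_refl [simp]: "desc n i n i"
  by (simp add: desc_def)

lemma desc_trans:
  assumes "desc m i n j" "desc n j l k"
  shows "desc m i l k"
proof -
  have "m - l = (m - n) + (n - l)" using assms by (simp add: desc_def)
  then have "(3::nat) ^ (m - l) = 3 ^ (m - n) * 3 ^ (n - l)" by (simp add: power_add)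
  then show ?thesis using assms by (auto simp: desc_def div_mult2_eq)
qed

lemma desc_exists: "n \<le> m \<Longrightarrow> \<exists>i. desc m i n j"
  by (rule exI[of _ "j * 3 ^ (m - n)"]) (simp add: desc_def)

lemma desc_bound:
  assumes "desc m i n j"
  shows "i < 3 ^ m \<longleftrightarrow> j < 3 ^ n"
proof -
  have "(3::nat) ^ m = 3 ^ n * 3 ^ (m - n)"
    using assms by (simp add: desc_def flip: power_add)
  then show ?thesis using assms by (auto simp: desc_def less_mult_imp_div_less div_less_iff_less_mult)
qed

lemma desc_cell:
  assumes "desc m i n j"
  shows "cell m i \<subseteq> cell n j"
proof -
  define p where "p = (3::nat) ^ (m - n)"
  have p: "p > 0" by (simp add: p_def)
  have pr: "(3::real) ^ m = 3 ^ n * real p"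
    using assms by (simp add: desc_def p_def flip: power_add)
  have j: "i div p = j" using assms by (simp add: desc_def p_def)
  have 1: "j * p \<le> i" using j by auto
  have "i < (j + 1) * p" using j p by (metis div_less_iff_less_mult less_add_one)
  then have 2: "i + 1 \<le> (j + 1) * p" by simp
  have 1: "real j * real p \<le> real i" using 1 by (metis of_nat_le_iff of_nat_mult)
  have "real (i + 1) \<le> real ((j + 1) * p)" using 2 by (simp only: of_nat_le_iff)
  then have 2: "real i + 1 \<le> (real j + 1) * real p" by (simp add: algebra_simps)
  have "real j / 3 ^ n = real j * real p / 3 ^ m" "(real j + 1) / 3 ^ n = (real j + 1) * real p / 3 ^ m"
    using p by (simp_all add: pr)
  then have "real j / 3 ^ n \<le> real i / 3 ^ m" "(real i + 1) / 3 ^ m \<le> (real j + 1) / 3 ^ n"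
    using 1 2 by (simp_all add: divide_right_mono)
  then show ?thesis unfolding cell_def by auto
qed

lemma desc_split:
  assumes "desc m i l k" "l \<le> n" "n \<le> m"
  obtains j where "desc m i n j" "desc n j l k"
proof
  show "desc m i n (i div 3 ^ (m - n))" using assms by (simp add: desc_def)
  have "m - l = (m - n) + (n - l)" using assms by simp
  then have "(3::nat) ^ (m - l) = 3 ^ (m - n) * 3 ^ (n - l)" by (simp add: power_add)
  then show "desc n (i div 3 ^ (m - n)) l k" using assms by (auto simp: desc_def div_mult2_eq)
qed

lemma desc_Suc: "desc (Suc n) i n j \<longleftrightarrow> i div 3 = j"
  by (simp add: desc_def)

lemma cell_nonempty: "cell n i \<noteq> {}"
  by (simp add: cell_def divide_right_mono)

lemma cell_diam: "x \<in> cell n i \<Longrightarrow> y \<in> cell n i \<Longrightarrow> \<bar>x - y\<bar> \<le> 1 / 3 ^ n"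
  by (auto simp: cell_def add_divide_distrib abs_le_iff)

lemma cell_sub_unit: "i < 3 ^ n \<Longrightarrow> cell n i \<subseteq> {0..1}"
proof -
  assume "i < 3 ^ n"
  then have "desc n i 0 0" by (simp add: desc_def)
  from desc_cell[OF this] show ?thesis by (simp add: cell_def)
qed

lemma cell_cover:
  assumes "x \<in> {0..1::real}"
  obtains i where "i < 3 ^ n" "x \<in> cell n i"
proof (cases "x = 1")
  case True
  have "x \<in> cell n (3 ^ n - 1)" by (simp add: True cell_def of_nat_diff)
  then show ?thesis using that[of "3 ^ n - 1"] by simp
next
  case False
  define i where "i = nat \<lfloor>x * 3 ^ n\<rfloor>"
  have i: "real i \<le> x * 3 ^ n" "x * 3 ^ n < real i + 1"
    using assms by (auto simp: i_def)
  have "x * 3 ^ n < 3 ^ n" using assms False by auto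
  then have "real i < 3 ^ n" by (rule le_less_trans[OF i(1)])
  then have "i < 3 ^ n" by simp
  moreover have "x \<in> cell n i" using i by (auto simp: cell_def field_simps)
  ultimately show ?thesis using that by blast
qed

lemma cell_inside:
  assumes "0 \<le> a" "a < b" "b \<le> (1::real)"
  obtains n i where "i < 3 ^ n" "cell n i \<subseteq> {a<..<b}"
proof -
  obtain n where n: "1 / (b - a) * 2 < 3 ^ n"
    using real_arch_pow[of 3 "1 / (b - a) * 2"] by auto
  obtain i where i: "i < 3 ^ n" "(a + b) / 2 \<in> cell n i"
    using cell_cover[of "(a + b) / 2" n] assms by auto
  have d: "1 / 3 ^ n < (b - a) / 2" using n assms by (simp add: field_simps)
  have "x \<in> {a<..<b}" if "x \<in> cell n i" for x
  proof -
    have "\<bar>x - (a + b) / 2\<bar> < (b - a) / 2" using cell_diam[OF that i(2)] d by linarith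
    then show ?thesis by (auto simp: abs_less_iff field_simps)
  qed
  then show ?thesis using that i by blast
qed



text \<open>\<open>lift3\<close> is the self-similarity: once a cell is carried exactly onto
  another, each child of the target is attained inside each third of the source, two levels deeper.
  Exact images, as opposed to inclusions, are what allows iteration.\<close>

locale cascade =
  fixes g :: "real \<Rightarrow> real" and M :: nat
  assumes cont: "continuous_on {0..1} g"
    and onto: "\<And>n i. M \<le> n \<Longrightarrow> i < 3 ^ (2 * n + 1) \<Longrightarrow> \<exists>j<3 ^ n. g ` cell (2 * n + 1) i = cell n j"
    and lift3: "\<And>n i j c e. M \<le> n \<Longrightarrow> i < 3 ^ (2 * n + 1) \<Longrightarrow> g ` cell (2 * n + 1) i = cell n j \<Longrightarrow>
       c div 3 = j \<Longrightarrow> e < 3 \<Longrightarrow>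
       \<exists>k. k div 3 = 3 * i + e \<and> g ` cell (2 * Suc n + 1) k = cell (Suc n) c"
begin

text \<open>The \<open>q\<close>-th iterate carries cells of level \<open>lev q n\<close> onto cells of level \<open>n\<close>.\<close>

definition lev :: "nat \<Rightarrow> nat \<Rightarrow> nat" where "lev q n = ((\<lambda>n. 2 * n + 1) ^^ q) n"

lemma lev_0 [simp]: "lev 0 n = n" by (simp add: lev_def)
lemma lev_Suc: "lev (Suc q) n = 2 * lev q n + 1" by (simp add: lev_def)
lemma lev_Suc': "lev (Suc q) n = lev q (2 * n + 1)"
  by (simp add: lev_def funpow_Suc_right del: funpow.simps)
lemma lev_ge: "n + q \<le> lev q n" by (induction q) (auto simp: lev_Suc)


text \<open>A branch: \<open>q\<close> successive links, each carrying a cell exactly onto the next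
  one. The links are recorded, and not just the image under the iterate, because
  \<open>lift3\<close> refines one link at a time.\<close>

fun br :: "nat \<Rightarrow> nat \<Rightarrow> nat \<Rightarrow> nat \<Rightarrow> bool" where
  "br 0 n i c \<longleftrightarrow> i = c"
| "br (Suc q) n i c \<longleftrightarrow> (\<exists>j. g ` cell (lev (Suc q) n) i = cell (lev q n) j \<and> br q n j c)"

lemma lift:
  assumes "M \<le> n" "i < 3 ^ (2 * n + 1)" "g ` cell (2 * n + 1) i = cell n j" "desc m c n j"
  shows "\<exists>k. desc (2 * m + 1) k (2 * n + 1) i \<and> g ` cell (2 * m + 1) k = cell m c"
proof -
  have "n \<le> m" using assms by (simp add: desc_def)
  then show ?thesis using assms(4)
  proof (induction m arbitrary: c rule: dec_induct)
    case base
    then show ?case using assms by (auto simp: desc_def)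
  next
    case (step m)
    obtain c' where c': "desc (Suc m) c m c'" "desc m c' n j"
      using desc_split[OF step.prems, of m] step.hyps by auto
    obtain k where k: "desc (2 * m + 1) k (2 * n + 1) i" "g ` cell (2 * m + 1) k = cell m c'"
      using step.IH[OF c'(2)] by blast
    have "k < 3 ^ (2 * m + 1)" using desc_bound[OF k(1)] assms(2) by simp
    from lift3[OF _ this k(2), of c 0] obtain k' where
      k': "k' div 3 = 3 * k" "g ` cell (2 * Suc m + 1) k' = cell (Suc m) c"
      using c'(1) step.hyps assms(1) by (auto simp: desc_Suc)
    have "k' div 9 = k" using k'(1) by linarith
    then have "desc (2 * Suc m + 1) k' (2 * m + 1) k"
      by (simp add: desc_def)
    then show ?case using k' desc_trans[OF _ k(1)] by blast
  qed
qed

lemma br_image: "br q n i c \<Longrightarrow> (g ^^ q) ` cell (lev q n) i = cell n c"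
proof (induction q arbitrary: i)
  case (Suc q)
  then obtain j where j: "g ` cell (lev (Suc q) n) i = cell (lev q n) j" "br q n j c" by auto
  have "(g ^^ Suc q) ` cell (lev (Suc q) n) i = (g ^^ q) ` (g ` cell (lev (Suc q) n) i)"
    by (simp add: funpow_swap1 image_image)
  then show ?case using Suc.IH[OF j(2)] j(1) by simp
qed simp

lemma br_append:
  "br q (lev p n) i s \<Longrightarrow> br p n s c \<Longrightarrow> br (q + p) n i c"
proof -
  have l: "lev q (lev p n) = lev (q + p) n" for q by (simp add: lev_def funpow_add)
  show "br q (lev p n) i s \<Longrightarrow> br p n s c \<Longrightarrow> br (q + p) n i c"
    by (induction q arbitrary: i) (auto simp: l)
qed

text \<open>The first application of the map leaves a free choice among the three thirds of the cell;
this freedom makes the sets of periodic points uncountable.\<close>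

lemma br_lift3:
  assumes "br (Suc q) n i c" "M \<le> n" "i < 3 ^ lev (Suc q) n" "c' div 3 = c" "e < 3"
  shows "\<exists>k. br (Suc q) (Suc n) k c' \<and> desc (lev (Suc q) (Suc n)) k (Suc (lev (Suc q) n)) (3 * i + e)"
  using assms
proof (induction q arbitrary: i e)
  case 0
  then have "g ` cell (2 * n + 1) i = cell n c" by (simp add: lev_Suc)
  from lift3[OF _ _ this, of c' e] 0 show ?case
    by (auto simp: lev_Suc desc_def)
next
  case (Suc q)
  let ?l = "lev (Suc q) n"
  obtain j where j: "g ` cell (lev (Suc (Suc q)) n) i = cell ?l j" "br (Suc q) n j c"
    using Suc.prems(1) by (metis br.simps(2))
  have l: "lev (Suc (Suc q)) n = 2 * ?l + 1" by (simp add: lev_Suc)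
  have ge: "M \<le> ?l" using lev_ge[of n "Suc q"] Suc.prems(2) by simp
  have ib: "i < 3 ^ (2 * ?l + 1)" using Suc.prems(3) l by simp
  have jb: "j < 3 ^ ?l"
  proof -
    obtain j' where j': "j' < 3 ^ ?l" "g ` cell (2 * ?l + 1) i = cell ?l j'" using onto[OF ge ib] by blast
    then have "cell ?l j' = cell ?l j" using j(1) l by simp
    then have "j' = j" by (simp add: cell_def Icc_eq_Icc divide_right_mono)
    then show ?thesis using j' by simp
  qed
  \<comment> \<open>The inner links always take third 0. The choice \<open>e\<close> is spent on the
    outermost link, whose source \<open>k2\<close> is then refined by \<open>lift\<close> until it
    fits the inner branch.\<close>
  obtain k1 where k1: "br (Suc q) (Suc n) k1 c'" "desc (lev (Suc q) (Suc n)) k1 (Suc ?l) (3 * j)"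
    using Suc.IH[OF j(2) Suc.prems(2) jb Suc.prems(4), of 0] by auto
  obtain k2 where k2: "k2 div 3 = 3 * i + e" "g ` cell (2 * Suc ?l + 1) k2 = cell (Suc ?l) (3 * j)"
    using lift3[OF ge ib, of j "3 * j" e] j(1) l Suc.prems(5) by auto
  have d2: "desc (2 * Suc ?l + 1) k2 (Suc (2 * ?l + 1)) (3 * i + e)"
    using k2(1) by (simp add: desc_def)
  have "desc (Suc (2 * ?l + 1)) (3 * i + e) (2 * ?l + 1) i" using Suc.prems(5) by (simp add: desc_Suc)
  then have "k2 < 3 ^ (2 * Suc ?l + 1)" using desc_bound[OF desc_trans[OF d2]] ib by blast
  from lift[OF _ this k2(2) k1(2)] ge obtain k where
    k: "desc (2 * lev (Suc q) (Suc n) + 1) k (2 * Suc ?l + 1) k2"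
       "g ` cell (2 * lev (Suc q) (Suc n) + 1) k = cell (lev (Suc q) (Suc n)) k1" by auto
  have "br (Suc (Suc q)) (Suc n) k c'"
    using k(2) k1(1) lev_Suc[of "Suc q" "Suc n"] by (metis br.simps(2))
  moreover have "desc (lev (Suc (Suc q)) (Suc n)) k (Suc (lev (Suc (Suc q)) n)) (3 * i + e)"
    using desc_trans[OF k(1) d2] by (simp add: l lev_Suc[of "Suc q" "Suc n"])
  ultimately show ?case by blast
qed

lemma br_lift:
  assumes "br q n i c" "M \<le> n" "i < 3 ^ lev q n" "desc m c' n c"
  shows "\<exists>k. br q m k c' \<and> desc (lev q m) k (lev q n) i"
  using assms
proof (induction q arbitrary: i)
  case 0
  then show ?case by auto
next
  case (Suc q)
  let ?l = "lev q n"
  obtain j where j: "g ` cell (2 * ?l + 1) i = cell ?l j" "br q n j c"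
    using Suc.prems(1) by (auto simp: lev_Suc)
  have ge: "M \<le> ?l" using lev_ge[of n q] Suc.prems(2) by simp
  have ib: "i < 3 ^ (2 * ?l + 1)" using Suc.prems(3) by (simp add: lev_Suc)
  obtain j' where j': "j' < 3 ^ ?l" "g ` cell (2 * ?l + 1) i = cell ?l j'" using onto[OF ge ib] by blast
  then have "cell ?l j' = cell ?l j" using j(1) by simp
  then have "j' = j" by (simp add: cell_def Icc_eq_Icc divide_right_mono)
  then have jb: "j < 3 ^ ?l" using j' by simp
  obtain k1 where k1: "br q m k1 c'" "desc (lev q m) k1 ?l j"
    using Suc.IH[OF j(2) Suc.prems(2) jb Suc.prems(4)] by auto
  from lift[OF ge ib j(1) k1(2)] show ?case
    using k1(1) by (auto simp: lev_Suc)
qed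

end

section \<open>Families of periodic points\<close>

text \<open>At the first binary place where the expansions differ, the smaller number has digit 0
  and the larger one digit 1. This makes the coding of periodic points by binary digits order
  preserving.\<close>

lemma first_binary_difference:
  fixes s t :: real
  assumes "0 \<le> s" "s < t" "t < 1"
  obtains k m where "\<And>j. j \<le> k \<Longrightarrow> \<lfloor>s * 2 ^ j\<rfloor> = \<lfloor>t * 2 ^ j\<rfloor>"
    "\<lfloor>s * 2 ^ Suc k\<rfloor> = 2 * m" "\<lfloor>t * 2 ^ Suc k\<rfloor> = 2 * m + 1"
proof -
  obtain n where n: "1 / (t - s) < 2 ^ n"
    using real_arch_pow[of 2 "1 / (t - s)"] by auto
  then have "s * 2 ^ n + 1 < t * 2 ^ n" using assms by (simp add: field_simps)
  then have ex: "\<lfloor>s * 2 ^ n\<rfloor> \<noteq> \<lfloor>t * 2 ^ n\<rfloor>" by linarith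
  define K where "K = (LEAST n. \<lfloor>s * 2 ^ n\<rfloor> \<noteq> \<lfloor>t * 2 ^ n\<rfloor>)"
  have K: "\<lfloor>s * 2 ^ K\<rfloor> \<noteq> \<lfloor>t * 2 ^ K\<rfloor>" unfolding K_def using ex by (rule LeastI)
  have lt: "\<lfloor>s * 2 ^ j\<rfloor> = \<lfloor>t * 2 ^ j\<rfloor>" if "j < K" for j
    using not_less_Least[of j "\<lambda>n. \<lfloor>s * 2 ^ n\<rfloor> \<noteq> \<lfloor>t * 2 ^ n\<rfloor>"] that unfolding K_def by blast
  have "\<lfloor>s\<rfloor> = 0" "\<lfloor>t\<rfloor> = 0" using assms by (auto simp: floor_eq_iff)
  then have "K \<noteq> 0" using K by (auto intro: ccontr)
  then obtain k where k: "K = Suc k" by (cases K) auto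
  define m where "m = \<lfloor>s * 2 ^ k\<rfloor>"
  have tm: "\<lfloor>t * 2 ^ k\<rfloor> = m" using lt[of k] k by (simp add: m_def)
  have s: "\<lfloor>s * 2 ^ K\<rfloor> = 2 * m \<or> \<lfloor>s * 2 ^ K\<rfloor> = 2 * m + 1"
    unfolding k m_def power_Suc by linarith
  have t: "\<lfloor>t * 2 ^ K\<rfloor> = 2 * m \<or> \<lfloor>t * 2 ^ K\<rfloor> = 2 * m + 1"
    using tm unfolding k power_Suc by linarith
  have "s * 2 ^ K \<le> t * 2 ^ K" using assms by simp
  then have "\<lfloor>s * 2 ^ K\<rfloor> \<le> \<lfloor>t * 2 ^ K\<rfloor>" by (rule floor_mono)
  then have "\<lfloor>s * 2 ^ K\<rfloor> = 2 * m" "\<lfloor>t * 2 ^ K\<rfloor> = 2 * m + 1" using s t K by auto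
  then show ?thesis using that[of k m] lt k by (metis less_Suc_eq_le)
qed

text \<open>A strictly increasing parametrization instead of an uncountable set: monotonicity gives
  measurability, and Lebesgue measure on the parameter interval pushes forward to a measure without
  atoms. The period \<open>q\<close> need not be the least one.\<close>

definition per_family :: "(real \<Rightarrow> real) \<Rightarrow> nat \<Rightarrow> (real \<Rightarrow> real) \<Rightarrow> bool" where
  "per_family g q \<psi> \<longleftrightarrow> 0 < q \<and> strict_mono_on {0..<1} \<psi> \<and>
     (\<forall>t\<in>{0..<1}. \<psi> t \<in> {0..1} \<and> (g ^^ q) (\<psi> t) = \<psi> t)"

context cascade
begin

text \<open>Nested cells are chosen so that at stage \<open>k\<close> the iterate
  \<open>g ^^ q\<close> carries the current cell onto its own ancestor of level
  \<open>n0 + k\<close>. The limit point and its image then share cells of arbitrarily small length,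
  so the point is fixed. The binary digits of \<open>t\<close> steer the free choice of a third at
  each stage.\<close>

lemma periodic_family:
  assumes "br q n0 i0 c0" "desc (lev q n0) i0 n0 c0" "M \<le> n0" "i0 < 3 ^ lev q n0" "0 < q"
  shows "\<exists>\<psi>. strict_mono_on {0..<1} \<psi> \<and>
    (\<forall>t\<in>{0..<1::real}. \<psi> t \<in> cell (lev q n0) i0 \<and> (g ^^ q) (\<psi> t) = \<psi> t)"
proof -
  define L where "L k = lev q (n0 + k)" for k
  define anc where "anc k i = i div 3 ^ (L k - (n0 + k))" for k i :: nat
  define Inv where "Inv k i \<longleftrightarrow> br q (n0 + k) i (anc k i) \<and> i < 3 ^ L k" for k i
  define nxt where "nxt k i e = (SOME i'. desc (L (Suc k)) i' (Suc (L k)) (3 * i + e) \<and> Inv (Suc k) i')"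
    for k i e
  have Lge: "Suc (n0 + k) \<le> L k" for k
    using lev_ge[of "n0 + k" q] assms(5) by (simp add: L_def)
  have nxt: "desc (L (Suc k)) (nxt k i e) (Suc (L k)) (3 * i + e) \<and> Inv (Suc k) (nxt k i e)"
    if "Inv k i" "e < 3" for k i e
  proof -
    obtain p where p: "q = Suc p" using assms(5) by (cases q) auto
    have d: "desc (L k) i (n0 + k) (anc k i)" using Lge[of k] by (simp add: desc_def anc_def)
    \<comment> \<open>The new target is the child of the old one that contains cell
      \<open>i\<close>. The refined cell therefore stays inside the cell onto which it is carried,
      and the invariant survives.\<close>
    then obtain c' where c': "desc (L k) i (Suc (n0 + k)) c'" "desc (Suc (n0 + k)) c' (n0 + k) (anc k i)"
      by (rule desc_split[of _ _ _ _ "Suc (n0 + k)"]) (use Lge[of k] in auto)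
    have "\<exists>i'. br (Suc p) (Suc (n0 + k)) i' c' \<and> desc (lev (Suc p) (Suc (n0 + k))) i' (Suc (lev (Suc p) (n0 + k))) (3 * i + e)"
      by (rule br_lift3[of p "n0 + k" i "anc k i"])
         (use that c' p assms(3) in \<open>auto simp: Inv_def L_def desc_Suc\<close>)
    then obtain i' where i': "br q (Suc (n0 + k)) i' c'" "desc (L (Suc k)) i' (Suc (L k)) (3 * i + e)"
      by (auto simp: p L_def)
    have d3: "desc (Suc (L k)) (3 * i + e) (L k) i" using that by (simp add: desc_Suc)
    have "desc (L (Suc k)) i' (Suc (n0 + k)) c'"
      by (rule desc_trans[OF desc_trans[OF i'(2) d3] c'(1)])
    then have "c' = anc (Suc k) i'" by (simp add: desc_def anc_def)
    moreover have "i' < 3 ^ L (Suc k)"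
      using desc_bound[OF desc_trans[OF i'(2) d3]] that by (simp add: Inv_def)
    ultimately have "desc (L (Suc k)) i' (Suc (L k)) (3 * i + e) \<and> Inv (Suc k) i'"
      using i' by (simp add: Inv_def)
    then show ?thesis unfolding nxt_def by (rule someI)
  qed
  define dig where "dig t k = nat (\<lfloor>t * 2 ^ Suc k\<rfloor> mod 2)" for t :: real and k
  have dig: "dig t k < 2" for t k by (simp add: dig_def nat_less_iff)
  define J where "J t = rec_nat i0 (\<lambda>k i. nxt k i (2 * dig t k))" for t
  have J0: "J t 0 = i0" and JS: "J t (Suc k) = nxt k (J t k) (2 * dig t k)" for t k
    by (simp_all add: J_def)
  have Inv: "Inv k (J t k)" for t k
  proof (induction k)
    case 0
    show ?case using assms by (simp add: Inv_def J0 anc_def L_def desc_def)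
  next
    case (Suc k)
    then show ?case using nxt[of k "J t k" "2 * dig t k"] dig[of t k] by (simp add: JS)
  qed
  have step: "desc (L (Suc k)) (J t (Suc k)) (Suc (L k)) (3 * J t k + 2 * dig t k)" for t k
    using nxt[OF Inv, of "2 * dig t k" k t] dig[of t k] by (simp add: JS)
  have step': "cell (L (Suc k)) (J t (Suc k)) \<subseteq> cell (L k) (J t k)" for t k
  proof (rule desc_cell[OF desc_trans[OF step]])
    show "desc (Suc (L k)) (3 * J t k + 2 * dig t k) (L k) (J t k)"
      using dig[of t k] by (simp add: desc_Suc)
  qed
  have "\<exists>x. \<forall>k. x \<in> cell (L k) (J t k)" for t
  proof -
    have "(\<Inter>k. cell (L k) (J t k)) \<noteq> {}"
    proof (rule compact_nest)
      show "cell (L n) (J t n) \<subseteq> cell (L m) (J t m)" if "m \<le> n" for m n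
        using lift_Suc_antimono_le[of "\<lambda>k. cell (L k) (J t k)", OF _ that] step' by blast
    qed (auto simp: cell_nonempty, simp add: cell_def)
    then show ?thesis by auto
  qed
  then obtain \<psi> where \<psi>: "\<psi> t \<in> cell (L k) (J t k)" for t k by metis
  have per: "(g ^^ q) (\<psi> t) = \<psi> t" for t
  proof -
    have le: "\<bar>(g ^^ q) (\<psi> t) - \<psi> t\<bar> \<le> 1 / 3 ^ (n0 + k)" for k
    proof (rule cell_diam)
      have "br q (n0 + k) (J t k) (anc k (J t k))" using Inv[of k t] by (simp add: Inv_def)
      from br_image[OF this] show "(g ^^ q) (\<psi> t) \<in> cell (n0 + k) (anc k (J t k))"
        using \<psi>[of t k] by (auto simp: L_def)
      have "desc (L k) (J t k) (n0 + k) (anc k (J t k))" using Lge[of k] by (simp add: desc_def anc_def)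
      from desc_cell[OF this] show "\<psi> t \<in> cell (n0 + k) (anc k (J t k))" using \<psi> by blast
    qed
    show ?thesis
    proof (rule ccontr)
      assume "(g ^^ q) (\<psi> t) \<noteq> \<psi> t"
      then have pos: "0 < \<bar>(g ^^ q) (\<psi> t) - \<psi> t\<bar>" by simp
      obtain k where k: "(1/3) ^ k < \<bar>(g ^^ q) (\<psi> t) - \<psi> t\<bar>"
        using real_arch_pow_inv[OF pos, of "1/3"] by auto
      have "1 / 3 ^ (n0 + k) \<le> (1/3::real) ^ k"
        by (simp add: power_add power_divide field_simps)
      with k le[of k] show False by linarith
    qed
  qed
  have mono: "\<psi> s < \<psi> t" if st: "0 \<le> s" "s < t" "t < 1" for s t :: real
  proof -
    obtain k m where k: "\<And>j. j \<le> k \<Longrightarrow> \<lfloor>s * 2 ^ j\<rfloor> = \<lfloor>t * 2 ^ j\<rfloor>"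
      "\<lfloor>s * 2 ^ Suc k\<rfloor> = 2 * m" "\<lfloor>t * 2 ^ Suc k\<rfloor> = 2 * m + 1"
      using first_binary_difference[OF st] by blast
    have "J s j = J t j" if "j \<le> k" for j
      using that
    proof (induction j)
      case (Suc j)
      have "dig s j = dig t j" unfolding dig_def using k(1)[of "Suc j"] Suc.prems by simp
      then show ?case using Suc by (simp add: JS)
    qed (simp add: J0)
    then have eq: "J s k = J t k" by simp
    have "dig s k = 0" "dig t k = 1" by (simp_all only: dig_def k) simp_all
    then have "\<psi> s \<in> cell (Suc (L k)) (3 * J t k)" "\<psi> t \<in> cell (Suc (L k)) (3 * J t k + 2)"
      using desc_cell[OF step[of k s]] desc_cell[OF step[of k t]] \<psi>[of s "Suc k"] \<psi>[of t "Suc k"] eq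
      by auto
    then have "\<psi> s \<le> (real (3 * J t k) + 1) / 3 ^ Suc (L k)"
       "real (3 * J t k + 2) / 3 ^ Suc (L k) \<le> \<psi> t"
      unfolding cell_def atLeastAtMost_iff by blast+
    moreover have "(real (3 * J t k) + 1) / 3 ^ Suc (L k) < real (3 * J t k + 2) / 3 ^ Suc (L k)"
      by (rule divide_strict_right_mono) auto
    ultimately show ?thesis by linarith
  qed
  have "strict_mono_on {0..<1} \<psi>" by (rule strict_mono_onI) (auto intro: mono)
  moreover have "\<psi> t \<in> cell (lev q n0) i0" for t using \<psi>[of t 0] by (simp add: L_def J0)
  ultimately show ?thesis using per by blast
qed

definition reach :: "nat \<Rightarrow> nat \<Rightarrow> nat \<Rightarrow> nat \<Rightarrow> bool" where
  "reach m l i c \<longleftrightarrow> (\<exists>i'. desc (lev m M) i' l i \<and> br m M i' c)"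

lemma br_range: "br q n i c \<Longrightarrow> M \<le> n \<Longrightarrow> i < 3 ^ lev q n \<Longrightarrow> c < 3 ^ n"
proof (induction q arbitrary: i)
  case (Suc q)
  let ?l = "lev q n"
  obtain j where j: "g ` cell (2 * ?l + 1) i = cell ?l j" "br q n j c"
    using Suc.prems(1) by (auto simp: lev_Suc)
  have ge: "M \<le> ?l" using lev_ge[of n q] Suc.prems(2) by simp
  have ib: "i < 3 ^ (2 * ?l + 1)" using Suc.prems(3) by (simp add: lev_Suc)
  obtain j' where j': "j' < 3 ^ ?l" "g ` cell (2 * ?l + 1) i = cell ?l j'" using onto[OF ge ib] by blast
  then have "cell ?l j' = cell ?l j" using j(1) by simp
  then have "j' = j" by (simp add: cell_def Icc_eq_Icc divide_right_mono)
  then show ?case using Suc.IH[OF j(2) Suc.prems(2)] j' by simp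
qed simp

lemma reach_some: "i < 3 ^ l \<Longrightarrow> \<exists>m c. reach m l i c"
proof (induction l arbitrary: i)
  case 0
  obtain i' where "desc M i' 0 i" using desc_exists[of 0 M i] by blast
  then have "reach 0 0 i i'" by (auto simp: reach_def)
  then show ?case by blast
next
  case (Suc l)
  show ?case
  proof (cases "Suc l \<le> M")
    case True
    obtain i' where "desc M i' (Suc l) i" using desc_exists[OF True] by blast
    then have "reach 0 (Suc l) i i'" by (auto simp: reach_def)
    then show ?thesis by blast
  next
    case False
    then have l: "M \<le> l" by simp
    obtain i1 where i1: "desc (2 * l + 1) i1 (Suc l) i" using desc_exists[of "Suc l" "2 * l + 1" i] by auto
    have b: "i1 < 3 ^ (2 * l + 1)" using desc_bound[OF i1] Suc.prems by simp
    obtain j where j: "j < 3 ^ l" "g ` cell (2 * l + 1) i1 = cell l j" using onto[OF l b] by blast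
    obtain m c where "reach m l j c" using Suc.IH[OF j(1)] by blast
    then obtain i2 where i2: "desc (lev m M) i2 l j" "br m M i2 c" by (auto simp: reach_def)
    obtain k where k: "desc (2 * lev m M + 1) k (2 * l + 1) i1" "g ` cell (2 * lev m M + 1) k = cell (lev m M) i2"
      using lift[OF l b j(2) i2(1)] by blast
    have "br (Suc m) M k c" using k(2) i2(2) by (auto simp: lev_Suc)
    then have "reach (Suc m) (Suc l) i c"
      unfolding reach_def using desc_trans[OF k(1) i1] by (auto simp: lev_Suc)
    then show ?thesis by blast
  qed
qed

end

text \<open>\<open>E\<close> is a graph on the blocks whose edges \<open>g\<close> realizes exactly.
  Growth of runs gives local eventual onto-ness, the loop gives all least periods, and the
  permutation gives itineraries that visit the blocks evenly.\<close>

locale spreading = cascade +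
  fixes E :: "nat \<Rightarrow> nat \<Rightarrow> bool" and \<sigma> :: "nat \<Rightarrow> nat"
  assumes edge: "\<And>i j. E i j \<Longrightarrow> i < 3 ^ M \<Longrightarrow> \<exists>s. desc (2 * M + 1) s M i \<and> g ` cell (2 * M + 1) s = cell M j"
    and grow: "\<And>a b. a < b \<Longrightarrow> b \<le> 3 ^ M \<Longrightarrow> \<exists>a' b'. b' \<le> 3 ^ M \<and> a' + min (3 ^ M) (Suc (b - a)) \<le> b' \<and>
       (\<forall>j. a' \<le> j \<and> j < b' \<longrightarrow> (\<exists>i. a \<le> i \<and> i < b \<and> E i j))"
    and loop: "\<exists>i<3 ^ M. E i i"
    and perm: "\<sigma> permutes {..<3 ^ M}" "\<And>i. i < 3 ^ M \<Longrightarrow> E i (\<sigma> i)"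
begin

lemma reach_step:
  assumes "reach m l i c" "E c j" "i < 3 ^ l"
  shows "reach (Suc m) l i j"
proof -
  obtain i' where i': "desc (lev m M) i' l i" "br m M i' c" using assms by (auto simp: reach_def)
  have b: "i' < 3 ^ lev m M" using desc_bound[OF i'(1)] assms by simp
  have "c < 3 ^ M" using br_range[OF i'(2) _ b] by simp
  then obtain s where s: "desc (2 * M + 1) s M c" "g ` cell (2 * M + 1) s = cell M j"
    using edge[OF assms(2)] by blast
  obtain k where k: "br m (2 * M + 1) k s" "desc (lev m (2 * M + 1)) k (lev m M) i'"
    using br_lift[OF i'(2) _ b s(1)] by blast
  have "br (m + 1) M k j"
    by (rule br_append[of _ 1]) (use k(1) s(2) in \<open>auto simp: lev_Suc\<close>)
  then show ?thesis unfolding reach_def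
    using desc_trans[OF k(2) i'(1)] by (auto simp: lev_Suc')
qed

lemma reach_all:
  assumes "i < 3 ^ l"
  shows "\<exists>m. \<forall>j<3 ^ M. reach (Suc m) l i j"
proof -
  \<comment> \<open>All blocks of the run are reached at the same time \<open>m\<close>; this makes
    the final time independent of \<open>j\<close>.\<close>
  have "\<exists>m a b. a + min (3 ^ M) (Suc k) \<le> b \<and> b \<le> 3 ^ M \<and> (\<forall>j. a \<le> j \<and> j < b \<longrightarrow> reach m l i j)" for k
  proof (induction k)
    case 0
    obtain m c where c: "reach m l i c" using reach_some[OF assms] by blast
    then obtain i' where i': "desc (lev m M) i' l i" "br m M i' c" by (auto simp: reach_def)
    have "c < 3 ^ M" using br_range[OF i'(2)] desc_bound[OF i'(1)] assms by simp
    then show ?case using c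
      by (intro exI[of _ m] exI[of _ c] exI[of _ "Suc c"]) (auto simp: le_less_Suc_eq)
  next
    case (Suc k)
    then obtain m a b where ab: "a + min (3 ^ M) (Suc k) \<le> b" "b \<le> 3 ^ M"
      "\<And>j. a \<le> j \<Longrightarrow> j < b \<Longrightarrow> reach m l i j" by blast
    have "(0::nat) < min (3 ^ M) (Suc k)" by simp
    then have "a < b" using ab(1) by linarith
    from grow[OF this ab(2)] obtain a' b' where ab': "b' \<le> 3 ^ M" "a' + min (3 ^ M) (Suc (b - a)) \<le> b'"
      "\<And>j. a' \<le> j \<Longrightarrow> j < b' \<Longrightarrow> \<exists>i. a \<le> i \<and> i < b \<and> E i j" by blast
    have "reach (Suc m) l i j" if "a' \<le> j" "j < b'" for j
      using ab'(3)[OF that] reach_step[OF ab(3) _ assms] by blast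
    moreover have "a' + min (3 ^ M) (Suc (Suc k)) \<le> b'" using ab(1) ab'(2) by linarith
    ultimately show ?case using ab'(1) by blast
  qed
  note grown = this
  have m3: "min (3 ^ M) (Suc (3 ^ M)) = (3::nat) ^ M" by simp
  from grown[of "3 ^ M", unfolded m3] obtain m a b where ab: "a + 3 ^ M \<le> b" "b \<le> 3 ^ M"
    "\<And>j. a \<le> j \<Longrightarrow> j < b \<Longrightarrow> reach m l i j" by blast
  then have full: "reach m l i j" if "j < 3 ^ M" for j using that by simp
  \<comment> \<open>One more step from the full run makes the time a successor;
    \<open>family_dense\<close> needs a positive period.\<close>
  obtain a' b' where ab': "b' \<le> 3 ^ M" "a' + min (3 ^ M) (Suc (3 ^ M - 0)) \<le> b'"
      "\<And>j. a' \<le> j \<Longrightarrow> j < b' \<Longrightarrow> \<exists>i. 0 \<le> i \<and> i < 3 ^ M \<and> E i j"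
    using grow[of 0 "3 ^ M"] by auto
  have "reach (Suc m) l i j" if "j < 3 ^ M" for j
    using ab'(3)[of j] ab'(1,2) that reach_step[OF full _ assms] by fastforce
  then show ?thesis by blast
qed

lemma maps_unit: "x \<in> {0..1} \<Longrightarrow> g x \<in> {0..1}"
proof -
  assume "x \<in> {0..1}"
  then obtain i where i: "i < 3 ^ (2 * M + 1)" "x \<in> cell (2 * M + 1) i" by (rule cell_cover)
  obtain j where "j < 3 ^ M" "g ` cell (2 * M + 1) i = cell M j" using onto[OF _ i(1)] by blast
  then show ?thesis using i(2) cell_sub_unit by blast
qed

lemma funpow_maps_unit: "x \<in> {0..1} \<Longrightarrow> (g ^^ n) x \<in> {0..1}"
  by (induction n) (auto simp del: atLeastAtMost_iff intro: maps_unit)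

lemma leo_g: "leo g"
  unfolding leo_def
proof (intro allI impI)
  fix a b :: real
  assume "0 \<le> a" "a < b" "b \<le> 1"
  then obtain n i where i: "i < 3 ^ n" "cell n i \<subseteq> {a<..<b}" by (rule cell_inside)
  obtain m where m: "\<And>j. j < 3 ^ M \<Longrightarrow> reach (Suc m) n i j" using reach_all[OF i(1)] by blast
  have "{0..1} \<subseteq> (g ^^ Suc m) ` {a<..<b}"
  proof
    fix x :: real assume "x \<in> {0..1}"
    then obtain j where j: "j < 3 ^ M" "x \<in> cell M j" by (rule cell_cover)
    then obtain i' where "desc (lev (Suc m) M) i' n i" "br (Suc m) M i' j" using m[OF j(1)] unfolding reach_def by blast
    then have "cell M j = (g ^^ Suc m) ` cell (lev (Suc m) M) i'" "cell (lev (Suc m) M) i' \<subseteq> cell n i"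
      using br_image desc_cell by blast+
    then show "x \<in> (g ^^ Suc m) ` {a<..<b}" using j(2) i(2) by blast
  qed
  moreover have "(g ^^ Suc m) ` {a<..<b} \<subseteq> {0..1}"
    using funpow_maps_unit \<open>0 \<le> a\<close> \<open>b \<le> 1\<close> by (force simp del: funpow.simps)
  ultimately show "\<exists>n. (g ^^ n) ` {a<..<b} = {0..1}" by blast
qed



lemma family_br:
  assumes "br q n i c" "desc (lev q n) i n c" "M \<le> n" "i < 3 ^ lev q n" "0 < q"
  shows "\<exists>\<psi>. per_family g q \<psi> \<and> (\<forall>t\<in>{0..<1}. \<psi> t \<in> cell (lev q n) i)"
  using periodic_family[OF assms] cell_sub_unit[OF assms(4)] assms(5)
  unfolding per_family_def by blast

text \<open>After a positive time the cell reaches the very block that contains it, and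
  \<open>periodic_family\<close> turns such a returning branch into periodic points.\<close>

lemma family_dense:
  assumes "i < 3 ^ l"
  shows "\<exists>q \<psi>. per_family g q \<psi> \<and> (\<forall>t\<in>{0..<1}. \<psi> t \<in> cell l i)"
proof -
  obtain i0 where i0: "desc (l + M) i0 l i" using desc_exists[of l "l + M" i] by auto
  have b0: "i0 < 3 ^ (l + M)" using desc_bound[OF i0] assms by simp
  obtain c where c: "desc (l + M) i0 M c" by (simp add: desc_def)
  have cb: "c < 3 ^ M" using desc_bound[OF c] b0 by simp
  obtain m where "reach (Suc m) (l + M) i0 c" using reach_all[OF b0] cb by blast
  then obtain i' where i': "desc (lev (Suc m) M) i' (l + M) i0" "br (Suc m) M i' c" by (auto simp: reach_def)
  have "i' < 3 ^ lev (Suc m) M" using desc_bound[OF i'(1)] b0 by simp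
  from family_br[OF i'(2) desc_trans[OF i'(1) c] order.refl this] show ?thesis
    using desc_cell[OF desc_trans[OF i'(1) i0]] by blast
qed

text \<open>A horseshoe in the loop block: disjoint cells \<open>R0\<close> and \<open>R2\<close>
  are both carried onto a cell \<open>C\<close> containing them. The itinerary with one visit to
  \<open>R0\<close> and then \<open>k - 1\<close> visits to \<open>R2\<close> cannot close up before
  time \<open>k\<close>.\<close>

lemma family_Per:
  assumes "0 < k"
  shows "\<exists>\<psi>. per_family g k \<psi> \<and> (\<forall>t\<in>{0..<1}. \<psi> t \<in> Per_k g k)"
proof -
  obtain i where i: "i < 3 ^ M" "E i i" using loop by blast
  obtain s where s: "desc (2 * M + 1) s M i" "g ` cell (2 * M + 1) s = cell M i" using edge i by blast
  have sb: "s < 3 ^ (2 * M + 1)" using desc_bound[OF s(1)] i by simp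
  \<comment> \<open>\<open>C\<close> is the child of the loop block that contains \<open>s\<close>.
    Lifting \<open>C\<close> into the first and the last third of \<open>s\<close> makes both lifts
    cover the place where they start.\<close>
  obtain C where C: "desc (2 * M + 1) s (M + 1) C" "desc (M + 1) C M i"
    using desc_split[OF s(1), of "M + 1"] by auto
  have "\<exists>R. R div 3 = 3 * s + e \<and> g ` cell (2 * Suc M + 1) R = cell (Suc M) C" if "e < 3" for e
    using lift3[OF order.refl sb s(2) _ that] C(2) by (simp add: desc_Suc)
  from this[of 0] this[of 2] obtain R0 R2 where
    R0: "R0 div 3 = 3 * s" "g ` cell (2 * Suc M + 1) R0 = cell (Suc M) C" and
    R2: "R2 div 3 = 3 * s + 2" "g ` cell (2 * Suc M + 1) R2 = cell (Suc M) C" by auto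
  have dR: "desc (2 * Suc M + 1) R (Suc (2 * M + 1)) (R div 3)" for R by (simp add: desc_def)
  have dS: "desc (Suc (2 * M + 1)) (3 * s + e) (2 * M + 1) s" if "e < 3" for e using that by (simp add: desc_Suc)
  have dR0: "desc (2 * Suc M + 1) R0 (Suc M) C" and dR2: "desc (2 * Suc M + 1) R2 (Suc M) C"
    using desc_trans[OF desc_trans[OF dR[of R0]], of "2 * M + 1" s "Suc M" C]
      desc_trans[OF desc_trans[OF dR[of R2]], of "2 * M + 1" s "Suc M" C]
      dS[of 0] dS[of 2] C(1) R0(1) R2(1) by auto
  have Cb: "C < 3 ^ Suc M" using desc_bound[OF C(1)] sb by simp
  have R0b: "R0 < 3 ^ (2 * Suc M + 1)" and R2b: "R2 < 3 ^ (2 * Suc M + 1)"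
    using desc_bound[OF dR0] desc_bound[OF dR2] Cb by auto
  have disj: "cell (2 * Suc M + 1) R0 \<inter> cell (2 * Suc M + 1) R2 = {}"
  proof -
    have "cell (2 * Suc M + 1) R0 \<subseteq> cell (Suc (2 * M + 1)) (3 * s)"
      "cell (2 * Suc M + 1) R2 \<subseteq> cell (Suc (2 * M + 1)) (3 * s + 2)"
      using desc_cell[OF dR[of R0]] desc_cell[OF dR[of R2]] R0(1) R2(1) by auto
    moreover have "cell n (3 * s) \<inter> cell n (3 * s + 2) = {}" for n
    proof -
      have "(real (3 * s) + 1) / 3 ^ n < real (3 * s + 2) / 3 ^ n" by (rule divide_strict_right_mono) auto
      then show ?thesis by (auto simp: cell_def)
    qed
    ultimately show ?thesis by blast
  qed
  have lm: "M \<le> Suc M" by simp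
  have chain: "\<exists>u. br q (Suc M) u C \<and> desc (lev q (Suc M)) u (Suc M) C \<and>
    (\<forall>x\<in>cell (lev q (Suc M)) u. \<forall>j<q. (g ^^ j) x \<in> cell (2 * Suc M + 1) R2)" for q
  proof (induction q)
    case 0
    then show ?case by (intro exI[of _ C]) auto
  next
    case (Suc q)
    then obtain u where u: "br q (Suc M) u C" "desc (lev q (Suc M)) u (Suc M) C"
      "\<And>x j. x \<in> cell (lev q (Suc M)) u \<Longrightarrow> j < q \<Longrightarrow> (g ^^ j) x \<in> cell (2 * Suc M + 1) R2" by blast
    obtain w where w: "desc (2 * lev q (Suc M) + 1) w (2 * Suc M + 1) R2"
       "g ` cell (2 * lev q (Suc M) + 1) w = cell (lev q (Suc M)) u"
      using lift[OF lm R2b R2(2) u(2)] by blast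
    have "(g ^^ j) x \<in> cell (2 * Suc M + 1) R2" if "x \<in> cell (lev (Suc q) (Suc M)) w" "j < Suc q" for x j
    proof (cases j)
      case 0
      then show ?thesis using that(1) desc_cell[OF w(1)] by (auto simp: lev_Suc)
    next
      case (Suc j')
      have "g x \<in> cell (lev q (Suc M)) u" using that(1) w(2) unfolding lev_Suc by blast
      from u(3)[OF this, of j'] show ?thesis using Suc that(2) by (simp add: funpow_swap1)
    qed
    moreover have "br (Suc q) (Suc M) w C" using u(1) w(2) by (auto simp: lev_Suc)
    moreover have "desc (lev (Suc q) (Suc M)) w (Suc M) C"
      using desc_trans[OF w(1) dR2] by (simp add: lev_Suc)
    ultimately show ?case by blast
  qed
  obtain q where q: "k = Suc q" using assms by (cases k) auto
  obtain u where u: "br q (Suc M) u C" "desc (lev q (Suc M)) u (Suc M) C"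
      "\<And>x j. x \<in> cell (lev q (Suc M)) u \<Longrightarrow> j < q \<Longrightarrow> (g ^^ j) x \<in> cell (2 * Suc M + 1) R2"
    using chain[of q] by blast
  obtain w where w: "desc (2 * lev q (Suc M) + 1) w (2 * Suc M + 1) R0"
       "g ` cell (2 * lev q (Suc M) + 1) w = cell (lev q (Suc M)) u"
    using lift[OF lm R0b R0(2) u(2)] by blast
  have w1: "br k (Suc M) w C" using u(1) w(2) by (auto simp: lev_Suc q)
  have w2: "desc (lev k (Suc M)) w (Suc M) C" using desc_trans[OF w(1) dR0] by (simp add: lev_Suc q)
  have w3: "w < 3 ^ lev k (Suc M)" using desc_bound[OF w2] Cb by simp
  obtain \<psi> where \<psi>: "per_family g k \<psi>" "\<And>t. t \<in> {0..<1} \<Longrightarrow> \<psi> t \<in> cell (lev k (Suc M)) w"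
    using family_br[OF w1 w2 lm w3 assms] by blast
  have "\<psi> t \<in> Per_k g k" if t: "t \<in> {0..<1}" for t
  proof -
    have x: "\<psi> t \<in> cell (2 * lev q (Suc M) + 1) w" using \<psi>(2)[OF t] by (simp add: q lev_Suc)
    then have x0: "\<psi> t \<in> cell (2 * Suc M + 1) R0" using desc_cell[OF w(1)] by blast
    have gx: "g (\<psi> t) \<in> cell (lev q (Suc M)) u" using x w(2) by blast
    have "(g ^^ i) (\<psi> t) \<noteq> \<psi> t" if i: "1 \<le> i" "i < k" for i
    proof -
      obtain i' where i': "i = Suc i'" using i by (cases i) auto
      have "(g ^^ i) (\<psi> t) \<in> cell (2 * Suc M + 1) R2"
        using u(3)[OF gx, of i'] i q by (simp add: i' funpow_swap1)
      then show ?thesis using x0 disj by auto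
    qed
    then show ?thesis using \<psi>(1) t unfolding Per_k_def per_family_def by auto
  qed
  then show ?thesis using \<psi>(1) by blast
qed

text \<open>Following the edges from \<open>i\<close> to \<open>\<sigma> i\<close> for
  \<open>q\<close> steps leads back to the starting block because \<open>\<sigma> ^^ q\<close> is
  the identity, so the branch closes up. The same \<open>q\<close> serves all blocks, which allows
  averaging over them.\<close>

lemma family_perm:
  assumes "(\<sigma> ^^ q) = id" "0 < q" "i < 3 ^ M"
  shows "\<exists>\<psi>. per_family g q \<psi> \<and> (\<forall>t\<in>{0..<1}. \<forall>j<q. (g ^^ j) (\<psi> t) \<in> cell M ((\<sigma> ^^ j) i))"
proof -
  have chain: "\<exists>u. br p M u ((\<sigma> ^^ p) i) \<and> desc (lev p M) u M i \<and>
    (\<forall>x\<in>cell (lev p M) u. \<forall>j<p. (g ^^ j) x \<in> cell M ((\<sigma> ^^ j) i))" if "i < 3 ^ M" for p i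
    using that
  proof (induction p arbitrary: i)
    case 0
    then show ?case by (intro exI[of _ i]) auto
  next
    case (Suc p)
    have "\<sigma> i < 3 ^ M" using permutes_in_image[OF perm(1), of i] Suc.prems by simp
    from Suc.IH[OF this] obtain u where u: "br p M u ((\<sigma> ^^ p) (\<sigma> i))" "desc (lev p M) u M (\<sigma> i)"
      "\<And>x j. x \<in> cell (lev p M) u \<Longrightarrow> j < p \<Longrightarrow> (g ^^ j) x \<in> cell M ((\<sigma> ^^ j) (\<sigma> i))" by blast
    obtain s where s: "desc (2 * M + 1) s M i" "g ` cell (2 * M + 1) s = cell M (\<sigma> i)"
      using edge perm(2) Suc.prems by blast
    have sb: "s < 3 ^ (2 * M + 1)" using desc_bound[OF s(1)] Suc.prems by simp
    obtain w where w: "desc (2 * lev p M + 1) w (2 * M + 1) s"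
       "g ` cell (2 * lev p M + 1) w = cell (lev p M) u"
      using lift[OF order.refl sb s(2) u(2)] by blast
    have dw: "desc (lev (Suc p) M) w M i" using desc_trans[OF w(1) s(1)] by (simp add: lev_Suc)
    have "(g ^^ j) x \<in> cell M ((\<sigma> ^^ j) i)" if "x \<in> cell (lev (Suc p) M) w" "j < Suc p" for x j
    proof (cases j)
      case 0
      then show ?thesis using that(1) desc_cell[OF dw] by auto
    next
      case (Suc j')
      have "g x \<in> cell (lev p M) u" using that(1) w(2) unfolding lev_Suc by blast
      from u(3)[OF this, of j'] show ?thesis using Suc that(2) by (simp add: funpow_swap1)
    qed
    moreover have "br (Suc p) M w ((\<sigma> ^^ Suc p) i)" using u(1) w(2) by (auto simp: lev_Suc funpow_swap1)
    ultimately show ?case using dw by blast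
  qed
  obtain u where u: "br q M u i" "desc (lev q M) u M i"
      "\<And>x j. x \<in> cell (lev q M) u \<Longrightarrow> j < q \<Longrightarrow> (g ^^ j) x \<in> cell M ((\<sigma> ^^ j) i)"
    using chain[OF assms(3), of q] assms(1) by auto
  have "u < 3 ^ lev q M" using desc_bound[OF u(2)] assms by simp
  from family_br[OF u(1,2) order.refl this assms(2)] show ?thesis using u(3) by blast
qed

end

section \<open>Invariant measures on periodic points\<close>

definition invariant_periodic_measure :: "(real \<Rightarrow> real) \<Rightarrow> real measure \<Rightarrow> bool" where
  "invariant_periodic_measure g \<mu> \<longleftrightarrow> prob_space \<mu> \<and> sets \<mu> = sets borel \<and>
     (\<forall>A\<in>sets borel. emeasure \<mu> (g -` A) = emeasure \<mu> A) \<and>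
     (\<forall>x. emeasure \<mu> {x} = 0) \<and> emeasure \<mu> (Per g) = 1"

section \<open>Mixtures of probability measures over a countable index\<close>

lemma
  fixes \<nu> :: "'i::countable \<Rightarrow> real measure" and p :: "'i pmf"
  assumes "\<And>i. prob_space (\<nu> i)" "\<And>i. sets (\<nu> i) = sets borel"
  shows prob_space_mixture: "prob_space (measure_pmf p \<bind> \<nu>)"
    and sets_mixture: "sets (measure_pmf p \<bind> \<nu>) = sets borel"
    and emeasure_mixture: "A \<in> sets borel \<Longrightarrow> emeasure (measure_pmf p \<bind> \<nu>) A = (\<integral>\<^sup>+i. emeasure (\<nu> i) A \<partial>p)"
proof -
  have k: "\<nu> \<in> measure_pmf p \<rightarrow>\<^sub>M prob_algebra borel"
    using assms by (auto simp: space_prob_algebra)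
  have "measure_pmf p \<in> space (prob_algebra (count_space UNIV))"
    by (simp add: space_prob_algebra measure_pmf.prob_space_axioms)
  moreover have "\<nu> \<in> count_space UNIV \<rightarrow>\<^sub>M prob_algebra borel"
    using assms by (auto simp: space_prob_algebra)
  ultimately show "prob_space (measure_pmf p \<bind> \<nu>)" "sets (measure_pmf p \<bind> \<nu>) = sets borel"
    by (rule prob_space_bind' sets_bind')+
  show "emeasure (measure_pmf p \<bind> \<nu>) A = (\<integral>\<^sup>+i. emeasure (\<nu> i) A \<partial>p)" if "A \<in> sets borel"
    by (rule emeasure_bind[OF _ measurable_prob_algebraD[OF k] that]) simp
qed

lemma measure_mixture_uniform:
  fixes \<nu> :: "nat \<Rightarrow> real measure"
  assumes "\<And>i. prob_space (\<nu> i)" "\<And>i. sets (\<nu> i) = sets borel" "A \<in> sets borel" "0 < n"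
  shows "measure (measure_pmf (pmf_of_set {..<n}) \<bind> \<nu>) A = (\<Sum>i<n. measure (\<nu> i) A) / n"
proof -
  have m: "emeasure (\<nu> i) A = ennreal (measure (\<nu> i) A)" for i
    using assms(1)[of i] by (simp add: prob_space_def finite_measure.emeasure_eq_measure)
  have ne: "{..<n} \<noteq> {}" using assms by auto
  have "emeasure (measure_pmf (pmf_of_set {..<n}) \<bind> \<nu>) A = (\<Sum>i<n. ennreal (measure (\<nu> i) A)) / n"
    using emeasure_mixture[where \<nu> = \<nu>, OF assms(1,2,3), of "pmf_of_set {..<n}"] nn_integral_pmf_of_set[OF ne]
    by (simp add: m)
  also have "\<dots> = ennreal ((\<Sum>i<n. measure (\<nu> i) A) / n)"
    using assms(4) by (simp add: sum_ennreal divide_ennreal ennreal_of_nat_eq_real_of_nat sum_nonneg)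
  finally show ?thesis
    by (simp add: measure_def sum_nonneg)
qed

lemma invariant_periodic_measure_mixture:
  fixes \<nu> :: "'i::countable \<Rightarrow> real measure"
  assumes "\<And>i. invariant_periodic_measure g (\<nu> i)" "g \<in> borel_measurable borel" "Per g \<in> sets borel"
  shows "invariant_periodic_measure g (measure_pmf p \<bind> \<nu>)"
proof -
  note a = assms(1)[unfolded invariant_periodic_measure_def]
  have 1: "\<And>i. prob_space (\<nu> i)" "\<And>i. sets (\<nu> i) = sets borel" using a by blast+
  have inv: "emeasure (\<nu> i) (g -` A) = emeasure (\<nu> i) A" if "A \<in> sets borel" for A i using a that by blast
  have nul: "emeasure (\<nu> i) {x} = 0" for i x using a by blast
  have full: "emeasure (\<nu> i) (Per g) = 1" for i using a by blast
  have "g -` A \<in> sets borel" if "A \<in> sets borel" for A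
    using measurable_sets[OF assms(2) that] by simp
  then show ?thesis
    unfolding invariant_periodic_measure_def
    using prob_space_mixture[where \<nu> = \<nu>, OF 1] sets_mixture[where \<nu> = \<nu>, OF 1] assms(3)
    by (simp add: emeasure_mixture[where \<nu> = \<nu>, OF 1] inv nul full)
qed

lemma mixture_pos:
  fixes \<nu> :: "'i::countable \<Rightarrow> real measure"
  assumes "\<And>i. prob_space (\<nu> i)" "\<And>i. sets (\<nu> i) = sets borel" "A \<in> sets borel"
    "i \<in> set_pmf p" "0 < emeasure (\<nu> i) A"
  shows "0 < emeasure (measure_pmf p \<bind> \<nu>) A"
proof -
  have "\<not> (AE i in measure_pmf p. emeasure (\<nu> i) A = 0)"
    using assms(4,5) by (auto simp: AE_measure_pmf_iff intro!: bexI[of _ i])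
  then have "(\<integral>\<^sup>+i. emeasure (\<nu> i) A \<partial>p) \<noteq> 0"
    by (subst nn_integral_0_iff_AE) auto
  then show ?thesis using emeasure_mixture[where \<nu> = \<nu>, OF assms(1-3), of p] by (simp add: zero_less_iff_neq_zero)
qed

section \<open>Measures carried by families of periodic points\<close>

locale unit_map =
  fixes g :: "real \<Rightarrow> real"
  assumes cont_g: "continuous_on UNIV g"
    and maps_unit_g: "\<And>x. x \<in> {0..1} \<Longrightarrow> g x \<in> {0..1}"
begin

lemma cont_funpow: "continuous_on UNIV (g ^^ n)"
proof (induction n)
  case (Suc n)
  then show ?case
    using continuous_on_compose[OF Suc continuous_on_subset[OF cont_g]] by simp
qed (simp add: id_def)

lemma borel_g [measurable]: "g \<in> borel_measurable borel"
  by (rule borel_measurable_continuous_onI[OF cont_g])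

lemma borel_funpow [measurable]: "(g ^^ n) \<in> borel_measurable borel"
  by (rule borel_measurable_continuous_onI[OF cont_funpow])

lemma Per_k_borel [measurable]: "Per_k g k \<in> sets borel"
proof -
  have "Per_k g k = {0..1} \<inter> {x \<in> space borel. (g ^^ k) x = x} \<inter> {x \<in> space borel. \<forall>i\<in>{1..<k}. (g ^^ i) x \<noteq> x}"
    by (auto simp: Per_k_def)
  also have "\<dots> \<in> sets borel" by measurable
  finally show ?thesis .
qed

lemma Per_borel [measurable]: "Per g \<in> sets borel"
  unfolding Per_def by measurable

lemma maps_unit_funpow: "x \<in> {0..1} \<Longrightarrow> (g ^^ n) x \<in> {0..1}"
  by (induction n) (auto simp del: atLeastAtMost_iff intro: maps_unit_g)

lemma fixed_in_Per:
  assumes "x \<in> {0..1}" "0 < q" "(g ^^ q) x = x"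
  shows "x \<in> Per g"
proof -
  define k where "k = (LEAST k. 0 < k \<and> (g ^^ k) x = x)"
  have "0 < k \<and> (g ^^ k) x = x" unfolding k_def by (rule LeastI[of _ q]) (use assms in auto)
  moreover have "(g ^^ i) x \<noteq> x" if "1 \<le> i" "i < k" for i
    using not_less_Least[of i "\<lambda>k. 0 < k \<and> (g ^^ k) x = x"] that unfolding k_def by auto
  ultimately have "x \<in> Per_k g k" "k \<in> {1..}" using assms by (auto simp: Per_k_def)
  then show ?thesis unfolding Per_def by blast
qed

definition fam_part :: "(real \<Rightarrow> real) \<Rightarrow> nat \<Rightarrow> real measure" where
  "fam_part \<psi> j = distr (restrict_space lborel {0..<1}) borel (\<lambda>t. (g ^^ j) (\<psi> t))"

definition fam_measure :: "nat \<Rightarrow> (real \<Rightarrow> real) \<Rightarrow> real measure" where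
  "fam_measure q \<psi> = measure_pmf (pmf_of_set {..<q}) \<bind> fam_part \<psi>"

context
  fixes q \<psi>
  assumes fam: "per_family g q \<psi>"
begin

lemma fam_measurable: "(\<lambda>t. (g ^^ j) (\<psi> t)) \<in> restrict_space lborel {0..<1} \<rightarrow>\<^sub>M borel"
proof -
  have "mono_on {0..<1} \<psi>" using fam by (simp add: per_family_def strict_mono_on_imp_mono_on)
  then have "\<psi> \<in> borel_measurable (restrict_space borel {0..<1})" by (rule borel_measurable_mono_on_fnc)
  moreover have "sets (restrict_space lborel {0..<1::real}) = sets (restrict_space borel {0..<1})"
    by (simp add: sets_restrict_space)
  ultimately have "\<psi> \<in> borel_measurable (restrict_space lborel {0..<1})"
    using measurable_cong_sets by blast
  then show ?thesis using measurable_compose[OF _ borel_funpow] by blast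
qed

lemma fam_part_sets: "sets (fam_part \<psi> j) = sets borel"
  by (simp add: fam_part_def)

lemma unit_prob: "prob_space (restrict_space lborel {0..<1::real})"
  by (intro prob_spaceI) (simp add: emeasure_restrict_space space_restrict_space)

lemma fam_part_prob: "prob_space (fam_part \<psi> j)"
  unfolding fam_part_def by (rule prob_space.prob_space_distr[OF unit_prob fam_measurable])

lemma emeasure_fam_part:
  "A \<in> sets borel \<Longrightarrow> emeasure (fam_part \<psi> j) A = emeasure lborel {t \<in> {0..<1}. (g ^^ j) (\<psi> t) \<in> A}"
  unfolding fam_part_def
  by (subst emeasure_distr[OF fam_measurable])
     (auto simp: emeasure_restrict_space space_restrict_space intro!: arg_cong[where f = "emeasure lborel"])

lemma fam_part_full:
  assumes "A \<in> sets borel" "\<And>t. t \<in> {0..<1} \<Longrightarrow> (g ^^ j) (\<psi> t) \<in> A"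
  shows "emeasure (fam_part \<psi> j) A = 1"
proof -
  have "{t \<in> {0..<1}. (g ^^ j) (\<psi> t) \<in> A} = {0..<1}" using assms(2) by auto
  then show ?thesis using emeasure_fam_part[OF assms(1)] by simp
qed

lemma emeasure_fam:
  assumes "A \<in> sets borel"
  shows "emeasure (fam_measure q \<psi>) A = (\<Sum>j<q. emeasure (fam_part \<psi> j) A) / q"
proof -
  have "{..<q} \<noteq> {}" using fam by (auto simp: per_family_def)
  then show ?thesis
    using emeasure_mixture[OF fam_part_prob fam_part_sets assms, of "pmf_of_set {..<q}"] nn_integral_pmf_of_set[of "{..<q}"]
    by (simp add: fam_measure_def)
qed

text \<open>Under \<open>g\<close> the part of index \<open>j\<close> moves to index
  \<open>j + 1\<close>, and index \<open>q\<close> is index 0 again, so the average over one period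
  is invariant. There are no atoms because the remaining \<open>q - j\<close> iterates recover
  \<open>\<psi> t\<close> from \<open>(g ^^ j) (\<psi> t)\<close>, which makes each part the image
  of Lebesgue measure under an injective map.\<close>

lemma fam_invariant: "invariant_periodic_measure g (fam_measure q \<psi>)"
proof -
  have q: "0 < q" and per: "\<And>t. t \<in> {0..<1} \<Longrightarrow> (g ^^ q) (\<psi> t) = \<psi> t"
    and unit: "\<And>t. t \<in> {0..<1} \<Longrightarrow> \<psi> t \<in> {0..1}" and sm: "strict_mono_on {0..<1} \<psi>"
    using fam by (auto simp: per_family_def)
  have sw: "(g ^^ a) ((g ^^ b) x) = (g ^^ b) ((g ^^ a) x)" for a b x
    by (metis add.commute comp_apply funpow_add)
  have inv: "emeasure (fam_measure q \<psi>) (g -` A) = emeasure (fam_measure q \<psi>) A" if A: "A \<in> sets borel" for A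
  proof -
    have gA: "g -` A \<in> sets borel" using measurable_sets[OF borel_g A] by simp
    define F where "F j = emeasure lborel {t \<in> {0..<1}. (g ^^ j) (\<psi> t) \<in> A}" for j
    have "{t \<in> {0..<1}. (g ^^ q) (\<psi> t) \<in> A} = {t \<in> {0..<1}. (g ^^ 0) (\<psi> t) \<in> A}" using per by auto
    then have "F q = F 0" by (simp only: F_def)
    have "(\<Sum>j<q. emeasure (fam_part \<psi> j) (g -` A)) = (\<Sum>j<q. F (Suc j))"
      by (simp add: emeasure_fam_part[OF gA] F_def)
    also have "\<dots> = (\<Sum>j<q. F j)"
    proof -
      obtain p where p: "q = Suc p" using q by (cases q) auto
      have "(\<Sum>j<q. F (Suc j)) = (\<Sum>j<p. F (Suc j)) + F q" by (simp add: p)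
      also have "\<dots> = F 0 + (\<Sum>j<p. F (Suc j))" by (simp add: \<open>F q = F 0\<close> add.commute)
      also have "\<dots> = (\<Sum>j<q. F j)" unfolding p by (rule sum.lessThan_Suc_shift[symmetric])
      finally show ?thesis .
    qed
    finally show ?thesis
      by (simp add: emeasure_fam[OF gA] emeasure_fam[OF A] emeasure_fam_part[OF A] F_def)
  qed
  have null: "emeasure (fam_measure q \<psi>) {x} = 0" for x
  proof -
    have "emeasure (fam_part \<psi> j) {x} = 0" if "j < q" for j
    proof -
      have "s = t" if "s \<in> {0..<1}" "t \<in> {0..<1}" "(g ^^ j) (\<psi> s) = x" "(g ^^ j) (\<psi> t) = x" for s t
      proof -
        have "(g ^^ (q - j)) ((g ^^ j) (\<psi> s)) = (g ^^ (q - j)) ((g ^^ j) (\<psi> t))" using that by simp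
        then have "(g ^^ q) (\<psi> s) = (g ^^ q) (\<psi> t)"
          using \<open>j < q\<close> by (metis comp_apply funpow_add le_add_diff_inverse2 less_imp_le)
        then have "\<psi> s = \<psi> t" using per that by simp
        then show ?thesis using sm that by (metis strict_mono_on_eqD)
      qed
      then have "\<exists>t. {t \<in> {0..<1}. (g ^^ j) (\<psi> t) \<in> {x}} \<subseteq> {t}" by blast
      then obtain t where "{t \<in> {0..<1}. (g ^^ j) (\<psi> t) \<in> {x}} \<subseteq> {t}" by blast
      then have "emeasure lborel {t \<in> {0..<1}. (g ^^ j) (\<psi> t) \<in> {x}} \<le> emeasure lborel {t}"
        by (rule emeasure_mono) simp
      then show ?thesis by (simp add: emeasure_fam_part)
    qed
    then show ?thesis by (simp add: emeasure_fam)
  qed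
  have "emeasure (fam_part \<psi> j) (Per g) = 1" for j
  proof (rule fam_part_full[OF Per_borel])
    fix t :: real assume t: "t \<in> {0..<1}"
    show "(g ^^ j) (\<psi> t) \<in> Per g"
      by (rule fixed_in_Per[OF maps_unit_funpow[OF unit[OF t]] q]) (simp add: sw[of q j] per[OF t])
  qed
  then have full: "emeasure (fam_measure q \<psi>) (Per g) = 1"
    using q by (simp add: emeasure_fam ennreal_of_nat_eq_real_of_nat divide_ennreal)
  have "prob_space (fam_measure q \<psi>)" "sets (fam_measure q \<psi>) = sets borel"
    unfolding fam_measure_def
    by (rule prob_space_mixture[OF fam_part_prob fam_part_sets] sets_mixture[OF fam_part_prob fam_part_sets])+
  then show ?thesis unfolding invariant_periodic_measure_def using inv null full by blast
qed

lemma fam_measure_pos: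
  assumes "A \<in> sets borel" "\<And>t. t \<in> {0..<1} \<Longrightarrow> \<psi> t \<in> A"
  shows "0 < emeasure (fam_measure q \<psi>) A"
  unfolding fam_measure_def
proof (rule mixture_pos[OF fam_part_prob fam_part_sets assms(1)])
  show "0 \<in> set_pmf (pmf_of_set {..<q})"
    using fam by (subst set_pmf_of_set) (auto simp: per_family_def)
  show "0 < emeasure (fam_part \<psi> 0) A" using fam_part_full[OF assms(1), of 0] assms(2) by simp
qed

lemma measure_fam_ge:
  assumes "A \<in> sets borel" "\<And>j t. j < q \<Longrightarrow> P j \<Longrightarrow> t \<in> {0..<1} \<Longrightarrow> (g ^^ j) (\<psi> t) \<in> A"
  shows "measure (fam_measure q \<psi>) A \<ge> (\<Sum>j<q. of_bool (P j)) / q"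
proof -
  have "of_bool (P j) \<le> measure (fam_part \<psi> j) A" if "j < q" for j
    using fam_part_full[OF assms(1), of j] assms(2)[OF that] by (auto simp: measure_def)
  then have "(\<Sum>j<q. of_bool (P j)) / q \<le> (\<Sum>j<q. measure (fam_part \<psi> j) A) / q"
    by (intro divide_right_mono sum_mono) auto
  then show ?thesis
    using measure_mixture_uniform[OF fam_part_prob fam_part_sets assms(1), of q] fam
    by (simp add: per_family_def fam_measure_def)
qed

end

text \<open>The families are averaged over their starting blocks. At each fixed time
  \<open>j\<close> the indices \<open>(\<sigma> ^^ j) i\<close> run through all blocks exactly once,
  so every block receives its share \<open>1 / N\<close>, and the distribution function errs by at
  most one block.\<close>

lemma equidistributed_measure:
  fixes \<sigma> :: "nat \<Rightarrow> nat" and N q :: nat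
  assumes "\<sigma> permutes {..<N}" "0 < q" "0 < N"
    "\<And>i. i < N \<Longrightarrow> \<exists>\<psi>. per_family g q \<psi> \<and>
      (\<forall>t\<in>{0..<1}. \<forall>j<q. (g ^^ j) (\<psi> t) \<in> {real ((\<sigma> ^^ j) i) / N .. (real ((\<sigma> ^^ j) i) + 1) / N})"
  shows "\<exists>\<mu>. invariant_periodic_measure g \<mu> \<and> (\<forall>x\<in>{0..1}. \<bar>measure \<mu> {..x} - x\<bar> \<le> 1 / N)"
proof -
  obtain \<psi> where \<psi>: "\<And>i. i < N \<Longrightarrow> per_family g q (\<psi> i)"
    "\<And>i t j. i < N \<Longrightarrow> t \<in> {0..<1} \<Longrightarrow> j < q \<Longrightarrow>
       (g ^^ j) (\<psi> i t) \<in> {real ((\<sigma> ^^ j) i) / N .. (real ((\<sigma> ^^ j) i) + 1) / N}"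
    using assms(4) by metis
  \<comment> \<open>Indices from \<open>N\<close> on are padded, since the mixture lemmas ask for a
    probability measure at every index.\<close>
  define \<nu> where "\<nu> i = fam_measure q (\<psi> (if i < N then i else 0))" for i
  define \<mu> where "\<mu> = measure_pmf (pmf_of_set {..<N}) \<bind> \<nu>"
  have inv: "invariant_periodic_measure g (\<nu> i)" for i
    unfolding \<nu>_def using fam_invariant \<psi>(1) assms(3) by simp
  have p: "prob_space (\<nu> i)" "sets (\<nu> i) = sets borel" for i
    using inv[of i] by (auto simp: invariant_periodic_measure_def)
  have good: "invariant_periodic_measure g \<mu>"
    unfolding \<mu>_def by (rule invariant_periodic_measure_mixture) (use inv in auto)
  then interpret prob_space \<mu> by (simp add: invariant_periodic_measure_def)
  have sets: "sets \<mu> = sets borel" using good by (simp add: invariant_periodic_measure_def)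
  \<comment> \<open>Closed neighbouring blocks share end points, so only lower bounds are derived;
    the upper bound for \<open>{..x}\<close> comes from the lower bound for the complement.\<close>
  have ge: "measure \<mu> A \<ge> card {i\<in>{..<N}. P i} / N"
    if A: "A \<in> sets borel" and P: "\<And>i x. i < N \<Longrightarrow> P i \<Longrightarrow> x \<in> {real i / N .. (real i + 1) / N} \<Longrightarrow> x \<in> A" for A P
  proof -
    have perm: "(\<sigma> ^^ j) permutes {..<N}" for j
    proof (induction j)
      case (Suc j)
      show ?case unfolding funpow.simps by (rule permutes_compose[OF Suc assms(1)])
    qed (simp only: funpow.simps permutes_id)
    have less: "(\<sigma> ^^ j) i < N" if "i < N" for i j using permutes_in_image[OF perm, of j i] that by simp
    have 1: "measure (\<nu> i) A \<ge> (\<Sum>j<q. of_bool (P ((\<sigma> ^^ j) i))) / q" if i: "i < N" for i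
    proof -
      have "(g ^^ j) (\<psi> i t) \<in> A" if "j < q" "P ((\<sigma> ^^ j) i)" "t \<in> {0..<1}" for j t
        by (rule P[OF less[OF i] that(2) \<psi>(2)[OF i that(3,1)]])
      then show ?thesis
        using measure_fam_ge[OF \<psi>(1)[OF i] A, of "\<lambda>j. P ((\<sigma> ^^ j) i)"] i by (simp add: \<nu>_def)
    qed
    have "(\<Sum>i<N. of_bool (P ((\<sigma> ^^ j) i))) = real (card {i\<in>{..<N}. P i})" for j
    proof -
      have "(\<Sum>i<N. of_bool (P ((\<sigma> ^^ j) i))) = (\<Sum>i<N. of_bool (P i) :: real)"
        by (rule sum.permute[OF perm, of "\<lambda>i. of_bool (P i)" j, unfolded comp_def, symmetric])
      also have "\<dots> = real (card {i\<in>{..<N}. P i})"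
        by (simp add: of_bool_def sum.If_cases Int_def)
      finally show ?thesis .
    qed
    then have "(\<Sum>i<N. \<Sum>j<q. of_bool (P ((\<sigma> ^^ j) i)) :: real) = q * card {i\<in>{..<N}. P i}"
      by (subst sum.swap) simp
    then have "(\<Sum>i<N. (\<Sum>j<q. of_bool (P ((\<sigma> ^^ j) i))) / real q) = real (card {i\<in>{..<N}. P i})"
      using assms(2) by (simp flip: sum_divide_distrib)
    moreover have "(\<Sum>i<N. (\<Sum>j<q. of_bool (P ((\<sigma> ^^ j) i))) / real q) \<le> (\<Sum>i<N. measure (\<nu> i) A)"
      by (rule sum_mono) (use 1 in auto)
    ultimately show ?thesis
      using measure_mixture_uniform[OF p A assms(3)] by (simp add: \<mu>_def divide_right_mono)
  qed
  have "\<bar>measure \<mu> {..x} - x\<bar> \<le> 1 / N" if x: "x \<in> {0..1}" for x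
  proof -
    define a where "a = nat \<lfloor>x * N\<rfloor>"
    have a: "real a \<le> x * N" "x * N < real a + 1" using x by (auto simp: a_def)
    have aN: "a \<le> N"
    proof -
      have "x * N \<le> N" using x by (simp add: mult_left_le_one_le)
      then have "real a \<le> N" using a by linarith
      then show ?thesis by simp
    qed
    have cl: "{i \<in> {..<N}. i < a} = {..<a}" using aN by auto
    have "measure \<mu> {..x} \<ge> card {i\<in>{..<N}. i < a} / N"
    proof (rule ge)
      fix i y assume "i < N" "i < a" "y \<in> {real i / N .. (real i + 1) / N}"
      then have "y \<le> (real i + 1) / N" "real i + 1 \<le> a" by auto
      then have "y \<le> a / N" by (meson divide_right_mono of_nat_0_le_iff order_trans)
      also have "\<dots> \<le> x" using a assms(3) by (simp add: field_simps)
      finally show "y \<in> {..x}" by simp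
    qed simp
    then have lo: "measure \<mu> {..x} \<ge> a / N" using cl by simp
    have hi: "measure \<mu> {..x} \<le> (real a + 1) / N"
    proof (cases "a < N")
      case False
      have "measure \<mu> {..x} \<le> 1" by simp
      also have "1 \<le> (real a + 1) / N" using False assms(3) by simp
      finally show ?thesis .
    next
      case True
      have "{i \<in> {..<N}. a < i} = {a<..<N}" by auto
      then have c: "card {i \<in> {..<N}. a < i} = N - a - 1" by simp
      have "measure \<mu> {x<..} \<ge> card {i\<in>{..<N}. a < i} / N"
      proof (rule ge)
        fix i y assume i: "i < N" "a < i" "y \<in> {real i / N .. (real i + 1) / N}"
        have "x < (real a + 1) / N" using a assms(3) by (simp add: field_simps)
        also have "\<dots> \<le> i / N" using i by (intro divide_right_mono) auto
        also have "\<dots> \<le> y" using i by simp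
        finally show "y \<in> {x<..}" by simp
      qed simp
      moreover have "measure \<mu> {x<..} = 1 - measure \<mu> {..x}"
      proof -
        have sp: "space \<mu> = UNIV" using sets_eq_imp_space_eq[OF sets] by simp
        have "{x<..} = space \<mu> - {..x}" by (auto simp: sp)
        then show ?thesis using prob_compl[of "{..x}"] sets by simp
      qed
      ultimately have "measure \<mu> {..x} \<le> 1 - real (N - a - 1) / N" using c by simp
      also have "\<dots> = (real a + 1) / N" using True by (simp add: field_simps of_nat_diff)
      finally show ?thesis .
    qed
    have "x \<le> (real a + 1) / N" using a(2) assms(3) by (simp add: pos_le_divide_eq)
    moreover have "a / N \<le> x" using a(1) assms(3) by (simp add: pos_divide_le_eq)
    ultimately have "a / N \<ge> x - 1 / N" "(real a + 1) / N \<le> x + 1 / N" by (simp_all add: add_divide_distrib)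
    with lo hi show ?thesis by linarith
  qed
  then show ?thesis using good by blast
qed

lemma full_support_measure:
  assumes dense: "\<And>l i. i < 3 ^ l \<Longrightarrow> \<exists>q \<psi>. per_family g q \<psi> \<and> (\<forall>t\<in>{0..<1}. \<psi> t \<in> cell l i)"
    and all_periods: "\<And>k. 0 < k \<Longrightarrow> \<exists>\<psi>. per_family g k \<psi> \<and> (\<forall>t\<in>{0..<1}. \<psi> t \<in> Per_k g k)"
  shows "\<exists>\<mu>. invariant_periodic_measure g \<mu> \<and>
    (\<forall>a b. 0 \<le> a \<longrightarrow> a < b \<longrightarrow> b \<le> 1 \<longrightarrow> 0 < emeasure \<mu> {a<..<b}) \<and>
    (\<forall>k\<ge>1. 0 < emeasure \<mu> (Per_k g k))"
proof -
  \<comment> \<open>The countably many sets that must get positive mass: one per least period and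
    one per cell. Invalid cell indices are sent to \<open>UNIV\<close>, so that every index has a
    family.\<close>
  define T where "T m = (case m of Inl k \<Rightarrow> Per_k g (Suc k)
      | Inr (l, i) \<Rightarrow> if i < 3 ^ l then cell l i else UNIV)" for m :: "nat + nat \<times> nat"
  have "\<exists>q \<psi>. per_family g q \<psi> \<and> (\<forall>t\<in>{0..<1}. \<psi> t \<in> T m)" for m
  proof (cases m)
    case (Inl k)
    then show ?thesis using all_periods[of "Suc k"] by (auto simp: T_def)
  next
    case (Inr li)
    then obtain l i where "m = Inr (l, i)" by (cases li) auto
    then show ?thesis using dense[of i l] all_periods[of 1] by (cases "i < 3 ^ l") (auto simp: T_def)
  qed
  then obtain q \<psi> where fam: "\<And>m. per_family g (q m) (\<psi> m)"
    and k: "\<And>m t. t \<in> {0..<1} \<Longrightarrow> \<psi> m t \<in> T m"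
    by metis
  \<comment> \<open>A geometric law transported along the surjection \<open>from_nat\<close> gives
    every index positive weight.\<close>
  define p where "p = map_pmf (from_nat :: nat \<Rightarrow> nat + nat \<times> nat) (geometric_pmf (1/2))"
  have p: "m \<in> set_pmf p" for m
    using surj_from_nat by (auto simp: p_def set_pmf_geometric)
  define \<mu> where "\<mu> = measure_pmf p \<bind> (\<lambda>m. fam_measure (q m) (\<psi> m))"
  have inv: "invariant_periodic_measure g (fam_measure (q m) (\<psi> m))" for m
    by (rule fam_invariant[OF fam])
  have pr: "prob_space (fam_measure (q m) (\<psi> m))" "sets (fam_measure (q m) (\<psi> m)) = sets borel" for m
    using inv[of m] by (auto simp: invariant_periodic_measure_def)
  have pos: "0 < emeasure \<mu> A" if "A \<in> sets borel" "\<And>t. t \<in> {0..<1} \<Longrightarrow> \<psi> m t \<in> A" for A m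
    unfolding \<mu>_def by (rule mixture_pos[where \<nu> = "\<lambda>m. fam_measure (q m) (\<psi> m)", OF pr that(1) p[of m] fam_measure_pos[OF fam that]])
  have "0 < emeasure \<mu> {a<..<b}" if "0 \<le> a" "a < b" "b \<le> 1" for a b
  proof -
    obtain n i where i: "i < 3 ^ n" "cell n i \<subseteq> {a<..<b}" using cell_inside[OF \<open>0 \<le> a\<close> \<open>a < b\<close> \<open>b \<le> 1\<close>] .
    show ?thesis by (rule pos[of _ "Inr (n, i)"]) (use i(1) subsetD[OF i(2)] k[of _ "Inr (n, i)"] in \<open>simp_all add: T_def\<close>)
  qed
  moreover have "0 < emeasure \<mu> (Per_k g k')" if "k' \<ge> 1" for k'
    by (rule pos[of _ "Inl (k' - 1)"]) (use that k[of _ "Inl (k' - 1)"] in \<open>auto simp: T_def\<close>)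
  moreover have "invariant_periodic_measure g \<mu>"
    unfolding \<mu>_def by (rule invariant_periodic_measure_mixture) (use inv in auto)
  ultimately show ?thesis by blast
qed

end

section \<open>Conjugation to Lebesgue measure\<close>

text \<open>The distribution function \<open>h\<close> of \<open>\<mu>\<close> is continuous since
  there are no atoms, strictly increasing on the unit interval by full support, and carries
  \<open>\<mu>\<close> to Lebesgue measure. Hence \<open>g\<close> conjugated by \<open>h\<close>
  preserves Lebesgue measure, while onto-ness and least periods are conjugacy invariants. The last
  conjunct is kept for the distance estimate.\<close>

lemma (in unit_map) conjugate:
  assumes inv: "invariant_periodic_measure g \<mu>"
    and supp: "\<And>a b. 0 \<le> a \<Longrightarrow> a < b \<Longrightarrow> b \<le> 1 \<Longrightarrow> 0 < emeasure \<mu> {a<..<b}"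
    and pos: "\<And>k. 1 \<le> k \<Longrightarrow> 0 < emeasure \<mu> (Per_k g k)"
    and leo: "leo g"
  shows "\<exists>G\<in>C_lambda. leo G \<and> emeasure lborel (Per G) = 1 \<and>
    (\<forall>k\<ge>1. 0 < emeasure lborel (Per_k G k)) \<and>
    (\<forall>x\<in>{0..1}. \<exists>y\<in>{0..1}. x = measure \<mu> {..y} \<and> G x = measure \<mu> {..g y})"
proof -
  define h where "h x = measure \<mu> {..x}" for x
  interpret prob_space \<mu> using inv by (simp add: invariant_periodic_measure_def)
  have sets: "sets \<mu> = sets borel" using inv by (simp add: invariant_periodic_measure_def)
  have space: "space \<mu> = UNIV" using sets_eq_imp_space_eq[OF sets] by simp
  interpret finite_borel_measure \<mu>
    by unfold_locales (simp_all add: sets)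
  have null: "measure \<mu> {x} = 0" for x using inv by (simp add: invariant_periodic_measure_def measure_def)
  have unit1: "emeasure \<mu> {0..1} = 1"
  proof -
    have "Per g \<subseteq> {0..1}" by (auto simp: Per_def Per_k_def)
    then have "emeasure \<mu> (Per g) \<le> emeasure \<mu> {0..1}" by (intro emeasure_mono) (auto simp: sets)
    then have "1 \<le> emeasure \<mu> {0..1}" using inv by (simp add: invariant_periodic_measure_def)
    with measure_le_1[of "{0..1}"] show ?thesis by (rule antisym)
  qed
  have AE: "AE y in \<mu>. y \<in> {0..1}"
  proof -
    have "{0..1} \<in> sets \<mu>" by (simp add: sets)
    moreover have "measure \<mu> {0..1} = 1" unfolding measure_def unit1 by simp
    ultimately show ?thesis using AE_in_set_eq_1 by blast
  qed
  have unit_int: "emeasure \<mu> (B \<inter> {0..1}) = emeasure \<mu> B" if "B \<in> sets borel" for B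
    by (rule emeasure_eq_AE) (use AE that in \<open>auto simp: sets\<close>)
  have h01: "0 \<le> h x" "h x \<le> 1" for x by (auto simp: h_def)
  have hmono: "x \<le> y \<Longrightarrow> h x \<le> h y" for x y
    unfolding h_def by (rule finite_measure_mono) (auto simp: sets)
  have h0: "h 0 = 0"
  proof -
    have "emeasure \<mu> {..0} = emeasure \<mu> ({..0} \<inter> {0..1})" by (rule unit_int[symmetric]) simp
    also have "{..0} \<inter> {0..1} = {0::real}" by auto
    finally show ?thesis using null[of 0] by (simp add: h_def measure_def)
  qed
  have h1: "h 1 = 1"
  proof -
    have "emeasure \<mu> {0..1} \<le> emeasure \<mu> {..1}" by (rule emeasure_mono) (auto simp: sets)
    then have "1 \<le> emeasure \<mu> {..1}" using unit1 by simp
    with measure_le_1[of "{..1}"] have "emeasure \<mu> {..1} = 1" by (rule antisym)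
    then show ?thesis by (simp add: h_def measure_def)
  qed
  have hstrict: "h x < h y" if "0 \<le> x" "x < y" "y \<le> 1" for x y
  proof -
    have "0 < measure \<mu> {x<..<y}" using supp[OF that] by (simp add: emeasure_eq_measure)
    also have "\<dots> \<le> measure \<mu> ({..y} - {..x})" by (rule finite_measure_mono) (auto simp: sets)
    also have "\<dots> = h y - h x"
      unfolding h_def by (rule finite_measure_Diff) (use that in \<open>auto simp: sets\<close>)
    finally show ?thesis by simp
  qed
  have hcont: "continuous_on UNIV h"
    using isCont_cdf null by (auto simp: continuous_at_imp_continuous_on h_def[abs_def] cdf_def[abs_def])
  have himg: "h ` {0..1} = {0..1}"
  proof
    show "h ` {0..1} \<subseteq> {0..1}" using h01 by auto
    show "{0..1} \<subseteq> h ` {0..1}"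
    proof
      fix x :: real assume "x \<in> {0..1}"
      then show "x \<in> h ` {0..1}"
        using IVT'[of h 0 x 1] h0 h1 continuous_on_subset[OF hcont] by (auto simp: image_iff)
    qed
  qed
  have hless: "h x < h y \<longleftrightarrow> x < y" if "x \<in> {0..1}" "y \<in> {0..1}" for x y
    using hstrict[of x y] hmono[of y x] that by fastforce
  have hinj: "inj_on h {0..1}"
    by (rule inj_onI) (metis hless less_irrefl linorder_neqE_linordered_idom)
  have hb: "h \<in> borel_measurable borel" by (rule borel_measurable_continuous_onI[OF hcont])
  have hm: "h \<in> \<mu> \<rightarrow>\<^sub>M borel" using hb sets measurable_cong_sets by blast
  have unif: "distr \<mu> borel h = uniform_measure lborel {0..1}"
  proof (rule measure_eqI_lessThan)
    fix x :: real
    have e1: "emeasure (distr \<mu> borel h) {x<..} = emeasure \<mu> {y. x < h y}"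
      by (subst emeasure_distr[OF hm]) (auto simp: space intro!: arg_cong[where f = "emeasure \<mu>"])
    have e2: "emeasure (uniform_measure lborel {0..1}) {x<..} = emeasure lborel ({0..1} \<inter> {x<..})"
      by (subst emeasure_uniform_measure) (auto simp: divide_ennreal_def)
    show "emeasure (distr \<mu> borel h) {x<..} < \<infinity>"
      unfolding e1 using emeasure_finite by (simp add: less_top[symmetric])
    consider "x < 0" | "0 \<le> x" "x < 1" | "1 \<le> x" by linarith
    then show "emeasure (distr \<mu> borel h) {x<..} = emeasure (uniform_measure lborel {0..1}) {x<..}"
    proof cases
      case 1
      then have "{y. x < h y} = UNIV" using h01(1) less_le_trans by blast
      moreover have "{0..1} \<inter> {x<..} = {0..1}" using 1 by auto
      ultimately show ?thesis unfolding e1 e2 using emeasure_space_1 by (simp add: space)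
    next
      case 2
      then obtain d where d: "d \<in> {0..1}" "x = h d" using himg by (metis atLeastAtMost_iff imageE less_imp_le)
      have "d < 1" using d 2 h1 by (cases "d = 1") auto
      have "{y. x < h y} = {d<..}"
      proof (intro set_eqI iffI)
        fix y assume "y \<in> {y. x < h y}"
        then show "y \<in> {d<..}" using hmono[of y d] d by (auto simp: not_le[symmetric])
      next
        fix y assume "y \<in> {d<..}"
        then have "h d < h (min y 1)" using hstrict[of d "min y 1"] d \<open>d < 1\<close> by auto
        also have "\<dots> \<le> h y" by (rule hmono) simp
        finally show "y \<in> {y. x < h y}" using d by simp
      qed
      also have "{d<..} = space \<mu> - {..d}" by (auto simp: space)
      finally have "emeasure \<mu> {y. x < h y} = ennreal (1 - x)"
        using prob_compl[of "{..d}"] by (simp add: emeasure_eq_measure sets h_def d)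
      moreover have "{0..1} \<inter> {x<..} = {x<..1}" using 2 by auto
      ultimately show ?thesis unfolding e1 e2 using 2 by simp
    next
      case 3
      then have "{y. x < h y} = {}" using h01(2) by (auto simp: not_less intro: order_trans)
      moreover have "{0..1} \<inter> {x<..} = {}" using 3 by auto
      ultimately show ?thesis unfolding e1 e2 by simp
    qed
  qed auto
  define k where "k = the_inv_into {0..1} h"
  have k: "k x \<in> {0..1}" "h (k x) = x" if "x \<in> {0..1}" for x
    using that himg the_inv_into_into[OF hinj, of x "{0..1}"] f_the_inv_into_f[OF hinj, of x]
    unfolding k_def by auto
  have kh: "k (h y) = y" if "y \<in> {0..1}" for y
    unfolding k_def by (rule the_inv_into_f_f[OF hinj that])
  have kcont: "continuous_on {0..1} k"
    using continuous_on_inv_into[OF continuous_on_subset[OF hcont subset_UNIV] _ hinj] himg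
    unfolding k_def by simp
  have image_meas: "h ` B \<in> sets borel" "emeasure lborel (h ` B) = emeasure \<mu> B"
    if B: "B \<in> sets borel" "B \<subseteq> {0..1}" for B
  proof -
    have eq: "h ` B = {x \<in> space (restrict_space borel {0..1}). k x \<in> B}"
    proof (intro set_eqI iffI)
      fix x assume "x \<in> h ` B"
      then show "x \<in> {x \<in> space (restrict_space borel {0..1}). k x \<in> B}"
        using B(2) kh h01 by (auto simp: space_restrict_space)
    next
      fix x assume "x \<in> {x \<in> space (restrict_space borel {0..1}). k x \<in> B}"
      then have "x \<in> {0..1}" "k x \<in> B" by (auto simp: space_restrict_space)
      then show "x \<in> h ` B" using k(2) by (metis imageI)
    qed
    have "k \<in> borel_measurable (restrict_space borel {0..1})"
      by (rule borel_measurable_continuous_on_restrict[OF kcont])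
    from measurable_sets_Collect[OF this, of "\<lambda>x. x \<in> B"] B(1)
    have "h ` B \<in> sets (restrict_space borel {0..1})" unfolding eq by simp
    then show meas: "h ` B \<in> sets borel" by (subst (asm) sets_restrict_space_iff) auto
    have sub: "h ` B \<subseteq> {0..1}" using h01 by auto
    have "emeasure lborel (h ` B) = emeasure (uniform_measure lborel {0..1}) (h ` B)"
      using meas sub by (subst emeasure_uniform_measure) (auto simp: divide_ennreal_def Int_absorb1)
    also have "\<dots> = emeasure \<mu> (h -` (h ` B))"
      unfolding unif[symmetric] using meas by (subst emeasure_distr[OF hm]) (auto simp: space)
    also have "\<dots> = emeasure \<mu> (h -` (h ` B) \<inter> {0..1})"
      using measurable_sets[OF hb meas] by (subst unit_int) auto
    also have "h -` (h ` B) \<inter> {0..1} = B"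
    proof (intro set_eqI iffI)
      fix y assume "y \<in> h -` (h ` B) \<inter> {0..1}"
      then obtain z where "h y = h z" "z \<in> B" "y \<in> {0..1}" by blast
      then show "y \<in> B" using inj_onD[OF hinj, of y z] B(2) by blast
    qed (use B(2) in auto)
    finally show "emeasure lborel (h ` B) = emeasure \<mu> B" .
  qed
  define G where "G x = h (g (k x))" for x
  have Gh: "G (h y) = h (g y)" if "y \<in> {0..1}" for y using kh[OF that] by (simp add: G_def)
  have Gn: "(G ^^ n) (h y) = h ((g ^^ n) y)" if "y \<in> {0..1}" for n y
    using that
  proof (induction n)
    case (Suc n)
    then show ?case using Gh[OF maps_unit_funpow[OF that, of n]] by simp
  qed simp
  have Per_kG: "Per_k G n = h ` Per_k g n" for n
  proof -
    have iff: "h y \<in> Per_k G n \<longleftrightarrow> y \<in> Per_k g n" if "y \<in> {0..1}" for y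
    proof -
      have "h ((g ^^ i) y) = h y \<longleftrightarrow> (g ^^ i) y = y" for i
        using inj_on_eq_iff[OF hinj maps_unit_funpow[OF that] that] .
      then show ?thesis using that h01 by (simp add: Per_k_def Gn[OF that])
    qed
    have "Per_k G n \<subseteq> h ` {0..1}" "Per_k g n \<subseteq> {0..1}" using himg by (auto simp: Per_k_def)
    then show ?thesis using iff by blast
  qed
  have PerG: "Per G = h ` Per g" unfolding Per_def Per_kG by blast
  have "G \<in> C_lambda"
    unfolding C_lambda_def
  proof (intro CollectI conjI ballI impI)
    have "continuous_on {0..1} (h \<circ> (g \<circ> k))"
      by (intro continuous_on_compose kcont continuous_on_subset[OF cont_g] continuous_on_subset[OF hcont]) auto
    then show "continuous_on {0..1} G" by (simp add: G_def[abs_def] comp_def)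
    show "G ` {0..1} \<subseteq> {0..1}" using h01 by (auto simp: G_def)
    fix A :: "real set" assume A: "A \<in> sets borel" "A \<subseteq> {0..1}"
    have hA: "h -` A \<in> sets borel" using measurable_sets[OF hb A(1)] by simp
    have ghA: "g -` (h -` A) \<in> sets borel" using measurable_sets[OF borel_g hA] by simp
    have "{x \<in> {0..1}. G x \<in> A} = h ` ((g -` (h -` A)) \<inter> {0..1})"
    proof (intro set_eqI iffI)
      fix x assume "x \<in> {x \<in> {0..1}. G x \<in> A}"
      then have x: "x \<in> {0..1}" "G x \<in> A" by auto
      then show "x \<in> h ` ((g -` (h -` A)) \<inter> {0..1})"
        by (intro image_eqI[of _ _ "k x"]) (use k[OF x(1)] in \<open>auto simp: G_def\<close>)
    next
      fix x assume "x \<in> h ` ((g -` (h -` A)) \<inter> {0..1})"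
      then obtain y where y: "x = h y" "y \<in> {0..1}" "h (g y) \<in> A" by auto
      then show "x \<in> {x \<in> {0..1}. G x \<in> A}" using Gh[OF y(2)] h01 by auto
    qed
    then have "emeasure lborel {x \<in> {0..1}. G x \<in> A} = emeasure \<mu> ((g -` (h -` A)) \<inter> {0..1})"
      using image_meas(2) ghA by simp
    also have "\<dots> = emeasure \<mu> (g -` (h -` A))" by (rule unit_int[OF ghA])
    also have "\<dots> = emeasure \<mu> (h -` A)" using inv hA by (simp add: invariant_periodic_measure_def)
    also have "\<dots> = emeasure \<mu> (h -` A \<inter> {0..1})" by (rule unit_int[OF hA, symmetric])
    also have "\<dots> = emeasure lborel (h ` (h -` A \<inter> {0..1}))"
      using image_meas(2)[of "h -` A \<inter> {0..1}"] hA by simp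
    also have "h ` (h -` A \<inter> {0..1}) = A"
    proof -
      have "x \<in> h ` (h -` A \<inter> {0..1})" if "x \<in> A" for x
        by (rule image_eqI[of _ _ "k x"]) (use k[of x] A(2) that in auto)
      then show ?thesis by auto
    qed
    finally show "emeasure lborel {x \<in> {0..1}. G x \<in> A} = emeasure lborel A" .
  qed
  moreover have "leo G"
    unfolding leo_def
  proof (intro allI impI)
    fix a b :: real assume ab: "0 \<le> a" "a < b" "b \<le> 1"
    then have ka: "k a \<in> {0..1}" "h (k a) = a" and kb: "k b \<in> {0..1}" "h (k b) = b"
      using k[of a] k[of b] by auto
    have "k a < k b" using hless[OF ka(1) kb(1)] ka kb ab by simp
    then obtain n where n: "(g ^^ n) ` {k a<..<k b} = {0..1}"
      using leo[unfolded leo_def, rule_format, of "k a" "k b"] ka kb by auto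
    have sub: "{k a<..<k b} \<subseteq> {0..1}" using ka kb by auto
    have img: "h ` {k a<..<k b} = {a<..<b}"
    proof (intro set_eqI iffI)
      fix x assume "x \<in> h ` {k a<..<k b}"
      then obtain y where y: "x = h y" "y \<in> {k a<..<k b}" by blast
      then have "y \<in> {0..1}" using sub by blast
      then have "h (k a) < h y" "h y < h (k b)" using hless[of "k a" y] hless[of y "k b"] ka(1) kb(1) y(2) by auto
      then show "x \<in> {a<..<b}" using ka kb y by simp
    next
      fix x assume x: "x \<in> {a<..<b}"
      then have kx: "k x \<in> {0..1}" "h (k x) = x" using k[of x] ab by auto
      then have "k x \<in> {k a<..<k b}" using hless[OF ka(1) kx(1)] hless[OF kx(1) kb(1)] ka kb x by simp
      then show "x \<in> h ` {k a<..<k b}" using kx(2) by (metis imageI)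
    qed
    have "(G ^^ n) ` {a<..<b} = (\<lambda>y. (G ^^ n) (h y)) ` {k a<..<k b}" by (simp add: img[symmetric] image_image)
    also have "\<dots> = (\<lambda>y. h ((g ^^ n) y)) ` {k a<..<k b}"
      by (rule image_cong) (use sub Gn in auto)
    also have "\<dots> = h ` ((g ^^ n) ` {k a<..<k b})" by (simp add: image_image)
    finally have "(G ^^ n) ` {a<..<b} = {0..1}" using n himg by simp
    then show "\<exists>n. (G ^^ n) ` {a<..<b} = {0..1}" by blast
  qed
  moreover have "emeasure lborel (Per G) = 1"
    unfolding PerG using inv by (subst image_meas(2)) (auto simp: invariant_periodic_measure_def Per_def Per_k_def)
  moreover have "0 < emeasure lborel (Per_k G n)" if "1 \<le> n" for n
  proof -
    have "Per_k g n \<subseteq> {0..1}" by (auto simp: Per_k_def)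
    then show ?thesis unfolding Per_kG using image_meas(2)[OF Per_k_borel] pos[OF that] by simp
  qed
  moreover have "\<exists>y\<in>{0..1}. x = h y \<and> G x = h (g y)" if "x \<in> {0..1}" for x
    using k[OF that] by (intro bexI[of _ "k x"]) (auto simp: G_def)
  ultimately show ?thesis unfolding h_def by blast
qed

text \<open>Mixing the full support measure into the equidistributed one with weight
  \<open>\<eta>\<close> keeps all positivity, and it moves the distribution function by at most
  \<open>\<eta>\<close> beyond the error \<open>1 / 3 ^ M\<close> already present.\<close>

lemma (in unit_map) lambda_conjugate:
  fixes \<sigma> :: "nat \<Rightarrow> nat" and M q :: nat
  assumes dense: "\<And>l i. i < 3 ^ l \<Longrightarrow> \<exists>q \<psi>. per_family g q \<psi> \<and> (\<forall>t\<in>{0..<1}. \<psi> t \<in> cell l i)"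
    and all_periods: "\<And>k. 0 < k \<Longrightarrow> \<exists>\<psi>. per_family g k \<psi> \<and> (\<forall>t\<in>{0..<1}. \<psi> t \<in> Per_k g k)"
    and perm: "\<sigma> permutes {..<3 ^ M}" "0 < q"
      "\<And>i. i < 3 ^ M \<Longrightarrow> \<exists>\<psi>. per_family g q \<psi> \<and>
         (\<forall>t\<in>{0..<1}. \<forall>j<q. (g ^^ j) (\<psi> t) \<in> cell M ((\<sigma> ^^ j) i))"
    and leo: "leo g"
  shows "\<exists>G\<in>C_lambda. leo G \<and> emeasure lborel (Per G) = 1 \<and>
    (\<forall>k\<ge>1. 0 < emeasure lborel (Per_k G k)) \<and>
    (\<forall>x\<in>{0..1}. \<exists>y\<in>{0..1}. \<bar>x - y\<bar> \<le> 2 / 3 ^ M \<and> \<bar>G x - g y\<bar> \<le> 2 / 3 ^ M)"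
proof -
  obtain \<mu>1 where \<mu>1: "invariant_periodic_measure g \<mu>1"
    "\<And>a b. 0 \<le> a \<Longrightarrow> a < b \<Longrightarrow> b \<le> 1 \<Longrightarrow> 0 < emeasure \<mu>1 {a<..<b}"
    "\<And>k. k \<ge> 1 \<Longrightarrow> 0 < emeasure \<mu>1 (Per_k g k)"
    using full_support_measure[OF dense all_periods] by blast
  obtain \<mu>0 where \<mu>0: "invariant_periodic_measure g \<mu>0"
    "\<And>x. x \<in> {0..1} \<Longrightarrow> \<bar>measure \<mu>0 {..x} - x\<bar> \<le> 1 / 3 ^ M"
    using equidistributed_measure[of \<sigma> "3 ^ M" q] perm by (auto simp: cell_def)
  \<comment> \<open>The exponent \<open>Suc M\<close> keeps \<open>\<eta>\<close> strictly below 1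
    even when \<open>M = 0\<close>.\<close>
  define \<eta> :: real where "\<eta> = 1 / 3 ^ Suc M"
  have \<eta>: "0 < \<eta>" "\<eta> < 1" "\<eta> \<le> 1 / 3 ^ M"
  proof -
    have "1 < 3 * (3::real) ^ M" using one_le_power[of "3::real" M] by linarith
    then show "0 < \<eta>" "\<eta> < 1" "\<eta> \<le> 1 / 3 ^ M" by (simp_all add: \<eta>_def field_simps)
  qed
  define \<nu> where "\<nu> b = (if b then \<mu>1 else \<mu>0)" for b :: bool
  define \<mu> where "\<mu> = measure_pmf (bernoulli_pmf \<eta>) \<bind> \<nu>"
  have inv: "invariant_periodic_measure g (\<nu> b)" for b using \<mu>0 \<mu>1 by (simp add: \<nu>_def)
  have pr: "prob_space (\<nu> b)" "sets (\<nu> b) = sets borel" for b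
    using inv[of b] by (auto simp: invariant_periodic_measure_def)
  have good: "invariant_periodic_measure g \<mu>"
    unfolding \<mu>_def by (rule invariant_periodic_measure_mixture) (use inv in auto)
  have pos: "0 < emeasure \<mu> A" if "A \<in> sets borel" "0 < emeasure \<mu>1 A" for A
    unfolding \<mu>_def
    by (rule mixture_pos[where \<nu> = \<nu>, OF pr that(1), of True]) (use \<eta> that in \<open>auto simp: \<nu>_def\<close>)
  have close: "\<bar>measure \<mu> {..x} - x\<bar> \<le> 2 / 3 ^ M" if "x \<in> {0..1}" for x
  proof -
    have m: "emeasure (\<nu> b) A = ennreal (measure (\<nu> b) A)" for b A
      using pr(1)[of b] by (simp add: prob_space_def finite_measure.emeasure_eq_measure)
    have "emeasure \<mu> {..x} = emeasure (\<nu> True) {..x} * \<eta> + emeasure (\<nu> False) {..x} * (1 - \<eta>)"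
      unfolding \<mu>_def using emeasure_mixture[where \<nu> = \<nu>, OF pr, of "{..x}" "bernoulli_pmf \<eta>"] \<eta> by simp
    also have "\<dots> = ennreal (measure \<mu>1 {..x} * \<eta> + measure \<mu>0 {..x} * (1 - \<eta>))"
      unfolding m using \<eta> by (simp add: \<nu>_def ennreal_mult ennreal_plus)
    finally have e: "measure \<mu> {..x} = measure \<mu>1 {..x} * \<eta> + measure \<mu>0 {..x} * (1 - \<eta>)"
      using \<eta> by (intro measure_eq_emeasure_eq_ennreal) (auto intro!: add_nonneg_nonneg mult_nonneg_nonneg)
    have p: "0 \<le> measure \<mu>1 {..x}" "measure \<mu>1 {..x} \<le> 1" "0 \<le> measure \<mu>0 {..x}" "measure \<mu>0 {..x} \<le> 1"
      using prob_space.prob_le_1[OF pr(1)[of True]] prob_space.prob_le_1[OF pr(1)[of False]] by (auto simp: \<nu>_def)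
    have "measure \<mu> {..x} - measure \<mu>0 {..x} = \<eta> * (measure \<mu>1 {..x} - measure \<mu>0 {..x})"
      by (simp add: e algebra_simps)
    then have "\<bar>measure \<mu> {..x} - measure \<mu>0 {..x}\<bar> = \<eta> * \<bar>measure \<mu>1 {..x} - measure \<mu>0 {..x}\<bar>"
      using \<eta> by (simp add: abs_mult)
    also have "\<dots> \<le> \<eta> * 1" using p \<eta> by (intro mult_left_mono) linarith+
    finally show ?thesis using \<mu>0(2)[OF that] \<eta>(3) by linarith
  qed
  obtain G where G: "G \<in> C_lambda" "leo G" "emeasure lborel (Per G) = 1"
    "\<And>k. 1 \<le> k \<Longrightarrow> 0 < emeasure lborel (Per_k G k)"
    "\<And>x. x \<in> {0..1} \<Longrightarrow> \<exists>y\<in>{0..1}. x = measure \<mu> {..y} \<and> G x = measure \<mu> {..g y}"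
    using conjugate[OF good pos pos leo] \<mu>1(2,3) by auto
  have "\<exists>y\<in>{0..1}. \<bar>x - y\<bar> \<le> 2 / 3 ^ M \<and> \<bar>G x - g y\<bar> \<le> 2 / 3 ^ M" if "x \<in> {0..1}" for x
    using G(5)[OF that] close maps_unit_g by (metis)
  then show ?thesis using G by blast
qed

section \<open>The self-similar map along a lattice walk\<close>

text \<open>Interpolation of the lattice path \<open>v\<close>, with \<open>A\<close> steps in the
  unit interval and values in units of \<open>1 / B\<close>. For a ramp \<open>y\<close> that is 0
  before and 1 after the unit interval, a summand contributes nothing before its own step and its
  whole increment afterwards; continuity then needs no gluing.\<close>

definition walk_map :: "nat \<Rightarrow> nat \<Rightarrow> (nat \<Rightarrow> int) \<Rightarrow> (real \<Rightarrow> real) \<Rightarrow> real \<Rightarrow> real" where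
  "walk_map A B v y x =
     (real_of_int (v 0) + (\<Sum>s<A. real_of_int (v (Suc s) - v s) * y (real A * x - real s))) / real B"

definition unit_ramp :: "(real \<Rightarrow> real) \<Rightarrow> bool" where
  "unit_ramp y \<longleftrightarrow> continuous_on UNIV y \<and> (\<forall>x\<le>0. y x = 0) \<and> (\<forall>x\<ge>1. y x = 1) \<and> (\<forall>x. 0 \<le> y x \<and> y x \<le> 1)"

lemma walk_map_cont:
  assumes "continuous_on UNIV y"
  shows "continuous_on UNIV (walk_map A B v y)"
proof -
  have "continuous_on UNIV (\<lambda>x. y (real A * x - real s))" for s
    by (rule continuous_on_compose2[OF assms]) (auto intro!: continuous_intros)
  then show ?thesis
    unfolding walk_map_def[abs_def] divide_inverse by (intro continuous_intros)
qed

lemma walk_map_piece: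
  assumes "unit_ramp y" "s < A" "u \<in> {0..1}"
  shows "walk_map A B v y ((real s + u) / real A) = (real_of_int (v s) + real_of_int (v (Suc s) - v s) * y u) / real B"
proof -
  have A: "real A * ((real s + u) / real A) = real s + u" using assms by simp
  let ?t = "\<lambda>s'. real_of_int (v (Suc s') - v s') * y (real s + u - real s')"
  have "(\<Sum>s'<A. ?t s') = (\<Sum>s'<s. ?t s') + (\<Sum>s'=s..<A. ?t s')"
    using assms(2) by (simp add: sum.atLeastLessThan_concat flip: atLeast0LessThan)
  also have "(\<Sum>s'=s..<A. ?t s') = ?t s + (\<Sum>s'=Suc s..<A. ?t s')"
    using assms(2) by (simp add: sum.atLeast_Suc_lessThan)
  also have "(\<Sum>s'=Suc s..<A. ?t s') = 0"
  proof (rule sum.neutral, rule ballI)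
    fix s' assume "s' \<in> {Suc s..<A}"
    then have "real (Suc s) \<le> real s'" by (simp only: of_nat_le_iff) simp
    then have "real s + u - real s' \<le> 0" using assms(3) by simp
    then show "?t s' = 0" using assms(1) by (simp add: unit_ramp_def)
  qed
  also have "(\<Sum>s'<s. ?t s') = (\<Sum>s'<s. real_of_int (v (Suc s')) - real_of_int (v s'))"
  proof (rule sum.cong[OF refl])
    fix s' assume "s' \<in> {..<s}"
    then have "real (Suc s') \<le> real s" by (simp only: of_nat_le_iff) simp
    then have "real s + u - real s' \<ge> 1" using assms(3) by simp
    then show "?t s' = real_of_int (v (Suc s')) - real_of_int (v s')" using assms(1) by (simp add: unit_ramp_def)
  qed
  also have "\<dots> = real_of_int (v s) - real_of_int (v 0)" by (rule sum_lessThan_telescope)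
  finally show ?thesis unfolding walk_map_def A by simp
qed

lemma unit_piece:
  assumes "x \<in> {0..1::real}" "0 < A"
  obtains s u where "s < A" "u \<in> {0..1}" "x = (real s + u) / real A"
proof (cases "x = 1")
  case True
  then show ?thesis using that[of "A - 1" 1] assms by (simp add: of_nat_diff)
next
  case False
  define s where "s = nat \<lfloor>x * A\<rfloor>"
  have s: "real s \<le> x * A" "x * A < real s + 1" using assms by (auto simp: s_def)
  have "x * A < A" using assms False by auto
  then have "real s < A" by (rule le_less_trans[OF s(1)])
  then have "s < A" by simp
  then show ?thesis using that[of s "x * A - s"] s assms by simp
qed

lemma walk_map_left: "unit_ramp y \<Longrightarrow> x \<le> 0 \<Longrightarrow> walk_map A B v y x = real_of_int (v 0) / B"
proof -
  assume y: "unit_ramp y" and x: "x \<le> 0"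
  have "(\<Sum>s<A. real_of_int (v (Suc s) - v s) * y (real A * x - real s)) = 0"
  proof (rule sum.neutral, rule ballI)
    fix s
    have "real A * x \<le> 0" using x by (simp add: mult_nonneg_nonpos)
    then have "real A * x - real s \<le> 0" by simp
    then show "real_of_int (v (Suc s) - v s) * y (real A * x - real s) = 0"
      using y by (simp add: unit_ramp_def)
  qed
  then show ?thesis by (simp add: walk_map_def)
qed

lemma walk_map_right: "unit_ramp y \<Longrightarrow> 1 \<le> x \<Longrightarrow> walk_map A B v y x = real_of_int (v A) / B"
proof -
  assume y: "unit_ramp y" and x: "1 \<le> x"
  have "(\<Sum>s<A. real_of_int (v (Suc s) - v s) * y (real A * x - real s))
     = (\<Sum>s<A. real_of_int (v (Suc s)) - real_of_int (v s))"
  proof (rule sum.cong[OF refl])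
    fix s assume "s \<in> {..<A}"
    then have "real (Suc s) \<le> real A" by (simp only: of_nat_le_iff) simp
    moreover have "real A \<le> real A * x" using x by (simp add: mult_le_cancel_left1)
    ultimately have "real A * x - real s \<ge> 1" by linarith
    then show "real_of_int (v (Suc s) - v s) * y (real A * x - real s) = real_of_int (v (Suc s)) - real_of_int (v s)"
      using y by (simp add: unit_ramp_def)
  qed
  also have "\<dots> = real_of_int (v A) - real_of_int (v 0)" by (rule sum_lessThan_telescope)
  finally show ?thesis by (simp add: walk_map_def)
qed

section \<open>The zigzag pattern and Peano's coordinate function\<close>

definition zigzag :: "nat \<Rightarrow> int" where
  "zigzag k = [0, 1, 2, 3, 2, 1, 0, 1, 2, 3] ! k"

lemma less9: "(k::nat) < 9 \<longleftrightarrow> k \<in> {0, 1, 2, 3, 4, 5, 6, 7, 8}"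
  by auto

lemma zigzag_step: "k < 9 \<Longrightarrow> \<bar>zigzag (Suc k) - zigzag k\<bar> = 1"
  unfolding less9 by (auto simp: zigzag_def)

lemma zigzag_range: "k < 9 \<Longrightarrow> zigzag k \<in> {0..3} \<and> zigzag (Suc k) \<in> {0..3}"
  unfolding less9 by (auto simp: zigzag_def)

text \<open>Each group of three steps crosses all three unit levels, upwards in the outer groups and
  downwards in the middle one; hence the witness \<open>5 - d\<close> there. This is the source of
  the free choice in \<open>lift3\<close>.\<close>

lemma zigzag_edge:
  assumes "d < 3" "e < 3"
  shows "\<exists>k<9. k div 3 = e \<and> min (zigzag k) (zigzag (Suc k)) = int d"
proof -
  define k where "k = (if e = 1 then 5 - d else 3 * e + d)"
  have "d \<in> {0, 1, 2}" "e \<in> {0, 1, 2}" using assms by auto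
  then show ?thesis by (intro exI[of _ k]) (auto simp: k_def zigzag_def)
qed

lemma unit_ramp_step:
  assumes "unit_ramp y"
  shows "unit_ramp (walk_map 9 3 zigzag y)"
proof -
  have z: "zigzag 0 = 0" "zigzag 9 = 3" by (auto simp: zigzag_def)
  have "0 \<le> walk_map 9 3 zigzag y x \<and> walk_map 9 3 zigzag y x \<le> 1" for x
  proof -
    consider "x \<le> 0" | "1 \<le> x" | "x \<in> {0..1}" by fastforce
    then show ?thesis
    proof cases
      case 3
      obtain s u where s: "s < 9" "u \<in> {0..1}" "x = (real s + u) / real 9" by (rule unit_piece[OF 3, of 9]) auto
      define a b where "a = real_of_int (zigzag s)" and "b = real_of_int (zigzag (Suc s))"
      have ab: "a \<in> {0..3}" "b \<in> {0..3}" using zigzag_range[OF s(1)] by (auto simp: a_def b_def)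
      have yu: "0 \<le> y u" "y u \<le> 1" using assms by (auto simp: unit_ramp_def)
      have e: "walk_map 9 3 zigzag y x = ((1 - y u) * a + y u * b) / 3"
        unfolding s(3) walk_map_piece[OF assms s(1,2)] by (simp add: a_def b_def algebra_simps)
      have "(1 - y u) * a + y u * b \<le> 3" by (rule convex_bound_le) (use ab yu in auto)
      moreover have "0 \<le> (1 - y u) * a + y u * b" using ab yu by auto
      ultimately show ?thesis unfolding e by simp
    qed (auto simp: walk_map_left[OF assms] walk_map_right[OF assms] z)
  qed
  then show ?thesis
    using assms walk_map_cont walk_map_left[OF assms] walk_map_right[OF assms]
    by (auto simp: unit_ramp_def z)
qed

text \<open>A coordinate function of Peano's curve: at every scale it runs three times across its range.\<close>

lemma peano_ramp:
  obtains Y where "unit_ramp Y"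
    "\<And>k u. k < 9 \<Longrightarrow> u \<in> {0..1} \<Longrightarrow>
       Y ((real k + u) / 9) = (real_of_int (zigzag k) + real_of_int (zigzag (Suc k) - zigzag k) * Y u) / 3"
proof -
  \<comment> \<open>Zigzag steps have size 1 and values are divided by 3, so
    \<open>walk_map 9 3 zigzag\<close> contracts uniform distances between ramps by the factor 1/3.
    \<open>Y\<close> is the limit of its iterates, and the required self-similarity is the fixed
    point equation.\<close>
  define y where "y n = (walk_map 9 3 zigzag ^^ n) (\<lambda>x. max 0 (min 1 x))" for n
  have yS: "y (Suc n) = walk_map 9 3 zigzag (y n)" for n by (simp add: y_def)
  have ramp: "unit_ramp (y n)" for n
  proof (induction n)
    case 0
    have "continuous_on UNIV (\<lambda>x::real. max 0 (min 1 x))" by (intro continuous_intros)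
    then show ?case by (simp add: y_def unit_ramp_def)
  qed (simp add: yS unit_ramp_step)
  have diff: "\<bar>y (Suc n) x - y n x\<bar> \<le> (1/3) ^ n" for n x
  proof (induction n arbitrary: x)
    case 0
    then show ?case using ramp[of 0] ramp[of 1] unfolding unit_ramp_def by (simp add: abs_le_iff) (smt (verit))
  next
    case (Suc n)
    consider "x \<le> 0" | "1 \<le> x" | "x \<in> {0..1}" by fastforce
    then show ?case
    proof cases
      case 1
      then show ?thesis using ramp by (simp add: unit_ramp_def)
    next
      case 2
      then show ?thesis using ramp by (simp add: unit_ramp_def)
    next
      case 3
      obtain s u where s: "s < 9" "u \<in> {0..1}" "x = (real s + u) / real 9" by (rule unit_piece[OF 3, of 9]) auto
      define d where "d = real_of_int (zigzag (Suc s) - zigzag s)"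
      have d: "\<bar>d\<bar> = 1" using zigzag_step[OF s(1)] unfolding d_def by (metis of_int_1 of_int_abs)
      have "y (Suc (Suc n)) x - y (Suc n) x = d * (y (Suc n) u - y n u) / 3"
        unfolding yS[of "Suc n"] unfolding yS[of n] s(3) walk_map_piece[OF ramp s(1,2)]
          walk_map_piece[OF unit_ramp_step[OF ramp] s(1,2)] d_def by (simp add: field_simps)
      then have "\<bar>y (Suc (Suc n)) x - y (Suc n) x\<bar> = \<bar>d\<bar> * \<bar>y (Suc n) u - y n u\<bar> / 3"
        by (simp only: abs_mult abs_divide abs_numeral)
      then have "\<bar>y (Suc (Suc n)) x - y (Suc n) x\<bar> = \<bar>y (Suc n) u - y n u\<bar> / 3" by (simp only: d mult_1)
      then show ?thesis using Suc[of u] by simp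
    qed
  qed
  define Y where "Y x = y 0 x + (\<Sum>i. y (Suc i) x - y i x)" for x
  have "uniform_limit UNIV (\<lambda>n x. \<Sum>i<n. y (Suc i) x - y i x) (\<lambda>x. \<Sum>i. y (Suc i) x - y i x) sequentially"
    by (rule Weierstrass_m_test[where M = "\<lambda>n. (1/3) ^ n"]) (use diff in \<open>auto intro: summable_geometric\<close>)
  then have "uniform_limit UNIV (\<lambda>n x. y 0 x + (\<Sum>i<n. y (Suc i) x - y i x)) Y sequentially"
    unfolding Y_def[abs_def] by (intro uniform_limit_intros)
  moreover have "y 0 x + (\<Sum>i<n. y (Suc i) x - y i x) = y n x" for n x
    using sum_lessThan_telescope[of "\<lambda>i. y i x" n] by simp
  ultimately have lim: "uniform_limit UNIV y Y sequentially" by simp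
  have pt: "(\<lambda>n. y n x) \<longlonglongrightarrow> Y x" for x by (rule tendsto_uniform_limitI[OF lim]) simp
  have cont: "continuous_on UNIV Y"
    by (rule uniform_limit_theorem[OF _ lim]) (use ramp in \<open>auto simp: unit_ramp_def\<close>)
  have "Y x = 0" if "x \<le> 0" for x
    using pt[of x] ramp that by (simp add: unit_ramp_def LIMSEQ_const_iff)
  moreover have "Y x = 1" if "1 \<le> x" for x
    using pt[of x] ramp that by (simp add: unit_ramp_def LIMSEQ_const_iff)
  moreover have "0 \<le> Y x" for x
    by (rule LIMSEQ_le_const[OF pt]) (use ramp in \<open>auto simp: unit_ramp_def\<close>)
  moreover have "Y x \<le> 1" for x
    by (rule LIMSEQ_le_const2[OF pt]) (use ramp in \<open>auto simp: unit_ramp_def\<close>)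
  ultimately have "unit_ramp Y" using cont by (simp add: unit_ramp_def)
  moreover have "Y ((real k + u) / 9) = (real_of_int (zigzag k) + real_of_int (zigzag (Suc k) - zigzag k) * Y u) / 3"
    if "k < 9" "u \<in> {0..1}" for k u
  proof (rule LIMSEQ_unique)
    show "(\<lambda>n. y (Suc n) ((real k + u) / 9)) \<longlonglongrightarrow> Y ((real k + u) / 9)"
      using pt by (rule LIMSEQ_Suc)
    have "y (Suc n) ((real k + u) / 9) = (real_of_int (zigzag k) + real_of_int (zigzag (Suc k) - zigzag k) * y n u) / 3" for n
      using walk_map_piece[OF ramp that, of 3 zigzag n] by (simp add: yS)
    then show "(\<lambda>n. y (Suc n) ((real k + u) / 9)) \<longlonglongrightarrow> (real_of_int (zigzag k) + real_of_int (zigzag (Suc k) - zigzag k) * Y u) / 3"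
      by (simp only:) (intro tendsto_intros pt, simp)
  qed
  ultimately show ?thesis using that by blast
qed

section \<open>The map carried by a lattice walk satisfies the cascade conditions\<close>

lemma cell_eq_iff: "cell n i = cell n j \<longleftrightarrow> i = j"
  by (auto simp: cell_def Icc_eq_Icc divide_right_mono)

locale zigzag_walk =
  fixes Y :: "real \<Rightarrow> real" and M :: nat and v :: "nat \<Rightarrow> int"
  assumes ramp: "unit_ramp Y"
    and self: "\<And>k u. k < 9 \<Longrightarrow> u \<in> {0..1} \<Longrightarrow>
       Y ((real k + u) / 9) = (real_of_int (zigzag k) + real_of_int (zigzag (Suc k) - zigzag k) * Y u) / 3"
    and step: "\<And>s. s < 3 ^ (2 * M + 1) \<Longrightarrow> \<bar>v (Suc s) - v s\<bar> = 1"
    and range: "\<And>s. s \<le> 3 ^ (2 * M + 1) \<Longrightarrow> 0 \<le> v s \<and> v s \<le> 3 ^ M"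
begin

definition g :: "real \<Rightarrow> real" where
  "g = walk_map (3 ^ (2 * M + 1)) (3 ^ M) v Y"

text \<open>The sign \<open>b - a\<close> is the orientation of the copy of \<open>Y\<close>. The
  image of the cell depends only on \<open>min a b\<close>, but the orientation decides in which
  order the children of the image are traversed.\<close>

definition piece :: "nat \<Rightarrow> nat \<Rightarrow> int \<Rightarrow> int \<Rightarrow> bool" where
  "piece n i a b \<longleftrightarrow> \<bar>b - a\<bar> = 1 \<and> 0 \<le> min a b \<and> max a b \<le> 3 ^ n \<and>
     (\<forall>u\<in>{0..1}. g ((real i + u) / 3 ^ (2 * n + 1)) = (real_of_int a + real_of_int (b - a) * Y u) / 3 ^ n)"

lemma piece_base: "s < 3 ^ (2 * M + 1) \<Longrightarrow> piece M s (v s) (v (Suc s))"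
proof -
  assume s: "s < 3 ^ (2 * M + 1)"
  then show ?thesis
    using range[of s] range[of "Suc s"] step[OF s] walk_map_piece[OF ramp s, of _ "3 ^ M" v]
    by (simp add: piece_def g_def)
qed

text \<open>The self-similarity of \<open>Y\<close> is substituted into the formula for the piece;
  the orientation of a child is the product of that of its parent and the zigzag step.\<close>

lemma piece_child:
  assumes "piece n i a b" "k < 9"
  shows "piece (Suc n) (9 * i + k) (3 * a + (b - a) * zigzag k) (3 * a + (b - a) * zigzag (Suc k))"
proof -
  have ab: "\<bar>b - a\<bar> = 1" "0 \<le> min a b" "max a b \<le> 3 ^ n" using assms by (auto simp: piece_def)
  have z: "\<bar>zigzag (Suc k) - zigzag k\<bar> = 1" "zigzag k \<in> {0..3}" "zigzag (Suc k) \<in> {0..3}"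
    using zigzag_step[OF assms(2)] zigzag_range[OF assms(2)] by auto
  have e: "3 * a + (b - a) * zigzag (Suc k) - (3 * a + (b - a) * zigzag k) = (b - a) * (zigzag (Suc k) - zigzag k)"
    by (simp add: algebra_simps)
  have 1: "\<bar>3 * a + (b - a) * zigzag (Suc k) - (3 * a + (b - a) * zigzag k)\<bar> = 1"
    unfolding e abs_mult using ab z by simp
  have r: "0 \<le> 3 * a + (b - a) * t \<and> 3 * a + (b - a) * t \<le> 3 ^ Suc n" if "t \<in> {0..3}" for t
  proof -
    have "b = a + 1 \<or> b = a - 1" using ab(1) by linarith
    then show ?thesis using that ab by (auto simp: min_def max_def)
  qed
  have "g ((real (9 * i + k) + u) / 3 ^ (2 * Suc n + 1)) =
    (real_of_int (3 * a + (b - a) * zigzag k) + real_of_int (3 * a + (b - a) * zigzag (Suc k) - (3 * a + (b - a) * zigzag k)) * Y u) / 3 ^ Suc n"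
    if u: "u \<in> {0..1}" for u
  proof -
    have "(real (9 * i + k) + u) / 3 ^ (2 * Suc n + 1) = (real i + (real k + u) / 9) / 3 ^ (2 * n + 1)"
      by (simp add: field_simps)
    moreover have "(real k + u) / 9 \<in> {0..1}" using assms(2) u by auto
    ultimately have "g ((real (9 * i + k) + u) / 3 ^ (2 * Suc n + 1)) =
       (real_of_int a + real_of_int (b - a) * Y ((real k + u) / 9)) / 3 ^ n"
      using assms(1) by (simp add: piece_def)
    then show ?thesis unfolding self[OF assms(2) u] e by (simp add: field_simps)
  qed
  then show ?thesis unfolding piece_def using 1 r z by auto
qed

lemma piece_exists: "M \<le> n \<Longrightarrow> i < 3 ^ (2 * n + 1) \<Longrightarrow> \<exists>a b. piece n i a b"
proof (induction n arbitrary: i rule: dec_induct)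
  case base
  then show ?case using piece_base by blast
next
  case (step n)
  have "i div 9 < 3 ^ (2 * n + 1)" using step.prems by (simp add: less_mult_imp_div_less)
  then obtain a b where "piece n (i div 9) a b" using step.IH by blast
  from piece_child[OF this, of "i mod 9"] show ?case by (auto simp: mult.commute)
qed

lemma Y_image: "Y ` {0..1} = {0..1}"
proof
  show "Y ` {0..1} \<subseteq> {0..1}" using ramp by (auto simp: unit_ramp_def)
  show "{0..1} \<subseteq> Y ` {0..1}"
  proof
    fix x :: real assume "x \<in> {0..1}"
    then show "x \<in> Y ` {0..1}"
      using IVT'[of Y 0 x 1] ramp continuous_on_subset[of UNIV Y "{0..1}"]
      by (auto simp: unit_ramp_def image_iff)
  qed
qed

lemma piece_image:
  assumes "piece n i a b"
  shows "g ` cell (2 * n + 1) i = cell n (nat (min a b))"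
proof -
  have cell: "cell (2 * n + 1) i = (\<lambda>u. (real i + u) / 3 ^ (2 * n + 1)) ` {0..1}"
  proof (intro set_eqI iffI)
    fix x assume x: "x \<in> cell (2 * n + 1) i"
    have "real i \<le> x * 3 ^ (2 * n + 1)" "x * 3 ^ (2 * n + 1) \<le> real i + 1"
      using x unfolding cell_def atLeastAtMost_iff by (simp_all only: pos_divide_le_eq pos_le_divide_eq zero_less_power zero_less_numeral)
    then show "x \<in> (\<lambda>u. (real i + u) / 3 ^ (2 * n + 1)) ` {0..1}"
      by (intro image_eqI[of _ _ "x * 3 ^ (2 * n + 1) - real i"]) auto
  qed (auto simp: cell_def divide_right_mono)
  have "g ` cell (2 * n + 1) i = (\<lambda>u. (real_of_int a + real_of_int (b - a) * Y u) / 3 ^ n) ` {0..1}"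
    unfolding cell image_image using assms by (intro image_cong) (auto simp: piece_def)
  also have "\<dots> = (\<lambda>t. (real_of_int a + real_of_int (b - a) * t) / 3 ^ n) ` {0..1}"
    by (subst (2) Y_image[symmetric]) (simp add: image_image)
  also have "\<dots> = cell n (nat (min a b))"
  proof -
    have ab: "b = a + 1 \<or> b = a - 1" "0 \<le> min a b" using assms by (auto simp: piece_def)
    have r: "real (nat (min a b)) = real_of_int (min a b)" using ab by simp
    show ?thesis
    proof (intro set_eqI iffI)
      fix x assume "x \<in> (\<lambda>t. (real_of_int a + real_of_int (b - a) * t) / 3 ^ n) ` {0..1}"
      then obtain t where t: "x = (real_of_int a + real_of_int (b - a) * t) / 3 ^ n" "t \<in> {0..1}" by blast
      have "real_of_int (min a b) \<le> real_of_int a + real_of_int (b - a) * t"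
        "real_of_int a + real_of_int (b - a) * t \<le> real_of_int (min a b) + 1"
        using ab t(2) by auto
      then show "x \<in> cell n (nat (min a b))" unfolding cell_def r t(1) atLeastAtMost_iff
        by (intro conjI divide_right_mono) auto
    next
      fix x assume x: "x \<in> cell n (nat (min a b))"
      have x': "real_of_int (min a b) \<le> x * 3 ^ n" "x * 3 ^ n \<le> real_of_int (min a b) + 1"
        using x unfolding cell_def r atLeastAtMost_iff by (simp_all add: field_simps)
      define t where "t = real_of_int (b - a) * (x * 3 ^ n - real_of_int a)"
      have "t \<in> {0..1}" using ab x' by (auto simp: t_def)
      moreover have "x = (real_of_int a + real_of_int (b - a) * t) / 3 ^ n"
        using ab by (auto simp: t_def)
      ultimately show "x \<in> (\<lambda>t. (real_of_int a + real_of_int (b - a) * t) / 3 ^ n) ` {0..1}" by blast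
    qed
  qed
  finally show ?thesis .
qed

lemma g_cont: "continuous_on UNIV g"
  unfolding g_def by (rule walk_map_cont) (use ramp in \<open>simp add: unit_ramp_def\<close>)

sublocale cascade g M
proof
  show "continuous_on {0..1} g" using g_cont continuous_on_subset by blast
  fix n i :: nat
  assume n: "M \<le> n" and i: "i < 3 ^ (2 * n + 1)"
  obtain a b where ab: "piece n i a b" using piece_exists[OF n i] by blast
  have "min a b < 3 ^ n" using ab by (auto simp: piece_def)
  moreover have "0 \<le> min a b" using ab by (auto simp: piece_def)
  ultimately have "nat (min a b) < 3 ^ n" by (simp add: nat_less_iff)
  then show "\<exists>j<3 ^ n. g ` cell (2 * n + 1) i = cell n j" using piece_image[OF ab] by blast
  fix j c e :: nat
  assume j: "g ` cell (2 * n + 1) i = cell n j" and c: "c div 3 = j" and e: "e < 3"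
  have jab: "int j = min a b" using j piece_image[OF ab] ab by (simp add: cell_eq_iff piece_def)
  define d where "d = c mod 3"
  have cd: "int c = 3 * int j + int d" using c by (simp add: d_def flip: of_nat_mult of_nat_add) presburger
  have d3: "d < 3" by (simp add: d_def)
  \<comment> \<open>A decreasing piece meets the children of its image in reversed order, so the
    last ternary digit of \<open>c\<close> is reflected.\<close>
  define d' where "d' = (if b = a + 1 then d else 2 - d)"
  have "d' < 3" using d3 by (auto simp: d'_def)
  then obtain k where k: "k < 9" "k div 3 = e" "min (zigzag k) (zigzag (Suc k)) = int d'"
    using zigzag_edge[OF _ e] by blast
  have z: "\<bar>zigzag (Suc k) - zigzag k\<bar> = 1" by (rule zigzag_step[OF k(1)])
  have "min (3 * a + (b - a) * zigzag k) (3 * a + (b - a) * zigzag (Suc k)) = int c"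
  proof -
    have "b = a + 1 \<or> b = a - 1" using ab by (auto simp: piece_def)
    then show ?thesis
    proof
      assume "b = a + 1"
      then show ?thesis using jab cd k(3) by (auto simp: d'_def min_def)
    next
      assume "b = a - 1"
      then show ?thesis using jab cd k(3) z d3 by (auto simp: d'_def min_def of_nat_diff)
    qed
  qed
  then have "g ` cell (2 * Suc n + 1) (9 * i + k) = cell (Suc n) c"
    using piece_image[OF piece_child[OF ab k(1)]] by simp
  moreover have "(9 * i + k) div 3 = 3 * i + e" using k(2) by simp
  ultimately show "\<exists>k. k div 3 = 3 * i + e \<and> g ` cell (2 * Suc n + 1) k = cell (Suc n) c" by blast
qed

lemma edge_image: "s < 3 ^ (2 * M + 1) \<Longrightarrow> g ` cell (2 * M + 1) s = cell M (nat (min (v s) (v (Suc s))))"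
  by (rule piece_image[OF piece_base])

end

section \<open>Lattice walks following a length-preserving map\<close>

definition lattice_walk :: "int \<Rightarrow> int \<Rightarrow> nat \<Rightarrow> (nat \<Rightarrow> int) \<Rightarrow> bool" where
  "lattice_walk l r n w \<longleftrightarrow> (\<forall>s<n. \<bar>w (Suc s) - w s\<bar> = 1) \<and> (\<forall>s\<le>n. l \<le> w s \<and> w s \<le> r)"

lemma lattice_walk_append:
  assumes "lattice_walk l r n w" "lattice_walk l r m u" "w n = u 0"
  shows "lattice_walk l r (n + m) (\<lambda>s. if s \<le> n then w s else u (s - n))"
  unfolding lattice_walk_def
proof (intro conjI allI impI)
  fix s assume s: "s < n + m"
  show "\<bar>(if Suc s \<le> n then w (Suc s) else u (Suc s - n)) - (if s \<le> n then w s else u (s - n))\<bar> = 1"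
  proof (cases "s < n")
    case True
    then show ?thesis using assms(1) by (simp add: lattice_walk_def)
  next
    case False
    then have "(if s \<le> n then w s else u (s - n)) = u (s - n)" using assms(3) by auto
    moreover have "\<bar>u (Suc (s - n)) - u (s - n)\<bar> = 1" using assms(2) s False by (simp add: lattice_walk_def)
    ultimately show ?thesis using False by (simp add: Suc_diff_le)
  qed
qed (use assms in \<open>auto simp: lattice_walk_def\<close>)

text \<open>Down from \<open>a\<close> to \<open>l\<close>, up to \<open>r\<close>, down to
  \<open>b\<close>: at most \<open>3 * (r - l)\<close> steps, and the ascent alone crosses every
  unit edge. The surplus is spent oscillating between \<open>b\<close> and a neighbour; by the
  parity hypothesis it is even, so the walk ends at \<open>b\<close>.\<close>

lemma covering_walk:
  fixes a b l r :: int
  assumes "l \<le> a" "a \<le> r" "l \<le> b" "b \<le> r" "l < r" "3 * (r - l) \<le> int n" "even (int n + a + b)"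
  shows "\<exists>w. lattice_walk l r n w \<and> w 0 = a \<and> w n = b \<and>
    (\<forall>j. l \<le> j \<and> j < r \<longrightarrow> (\<exists>s<n. min (w s) (w (Suc s)) = j))"
proof -
  define n1 n2 n3 n4 where "n1 = nat (a - l)" and "n2 = nat (r - l)" and "n3 = nat (r - b)"
    and "n4 = n - (n1 + n2 + n3)"
  have le: "n1 + n2 + n3 \<le> n" using assms by (simp add: n1_def n2_def n3_def)
  have i1: "int n1 = a - l" and i2: "int n2 = r - l" and i3: "int n3 = r - b"
    using assms by (simp_all add: n1_def n2_def n3_def)
  have i4: "int n4 = int n - (int n1 + int n2 + int n3)"
    unfolding n4_def using le by (simp add: of_nat_diff)
  have n: "n1 + n2 + n3 + n4 = n" using le by (simp add: n4_def)
  have ev: "even n4"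
  proof -
    have "int n4 = int n + a + b - 2 * (a + r - l)" using i1 i2 i3 i4 by (simp add: algebra_simps)
    moreover have "even (int n + a + b - 2 * (a + r - l))" by (rule dvd_diff[OF assms(7) dvd_triv_left])
    ultimately have "even (int n4)" by simp
    then show ?thesis by simp
  qed
  \<comment> \<open>The neighbour of \<open>b\<close> must stay in the range; for
    \<open>b = r\<close> the lower one does because \<open>l < r\<close>.\<close>
  define \<delta> :: int where "\<delta> = (if b < r then 1 else -1)"
  define w1 w2 w3 w4 where "w1 s = a - int s" and "w2 s = l + int s" and "w3 s = r - int s"
    and "w4 s = (if even s then b else b + \<delta>)" for s :: nat
  have w1: "lattice_walk l r n1 w1" using i1 assms by (auto simp: lattice_walk_def w1_def)
  have w2: "lattice_walk l r n2 w2" using i2 assms by (auto simp: lattice_walk_def w2_def)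
  have w3: "lattice_walk l r n3 w3" using i3 assms by (auto simp: lattice_walk_def w3_def)
  have w4: "lattice_walk l r n4 w4" using assms by (auto simp: lattice_walk_def w4_def \<delta>_def)
  define u1 where "u1 s = (if s \<le> n1 then w1 s else w2 (s - n1))" for s
  define u2 where "u2 s = (if s \<le> n1 + n2 then u1 s else w3 (s - (n1 + n2)))" for s
  define u3 where "u3 s = (if s \<le> n1 + n2 + n3 then u2 s else w4 (s - (n1 + n2 + n3)))" for s
  have u1: "lattice_walk l r (n1 + n2) u1"
    unfolding u1_def by (rule lattice_walk_append[OF w1 w2]) (simp add: w1_def w2_def i1)
  have e1: "u1 (n1 + n2) = r" by (cases "n2 = 0") (use i1 i2 assms in \<open>auto simp: u1_def w1_def w2_def\<close>)
  have u2: "lattice_walk l r (n1 + n2 + n3) u2"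
    unfolding u2_def by (rule lattice_walk_append[OF u1 w3]) (simp add: e1 w3_def)
  have e2: "u2 (n1 + n2 + n3) = b"
    by (cases "n3 = 0") (use e1 i3 in \<open>auto simp: u2_def w3_def\<close>)
  have u3: "lattice_walk l r n u3"
    unfolding u3_def n[symmetric] by (rule lattice_walk_append[OF u2 w4]) (simp add: e2 w4_def)
  have e3: "u3 n = b"
    unfolding n[symmetric] by (cases "n4 = 0") (use e2 ev in \<open>auto simp: u3_def w4_def\<close>)
  have e0: "u3 0 = a" by (simp add: u3_def u2_def u1_def w1_def)
  have "\<exists>s<n. min (u3 s) (u3 (Suc s)) = j" if j: "l \<le> j" "j < r" for j
  proof (intro exI conjI)
    define s where "s = nat (j - l)"
    have s: "int s = j - l" "s < n2" using j i2 by (auto simp: s_def)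
    show "n1 + s < n" using s n by linarith
    have "u1 (n1 + s) = j" by (cases "s = 0") (use s i1 in \<open>auto simp: u1_def w1_def w2_def\<close>)
    moreover have "u1 (Suc (n1 + s)) = j + 1" using s by (auto simp: u1_def w2_def)
    ultimately show "min (u3 (n1 + s)) (u3 (Suc (n1 + s))) = j" using s by (simp add: u3_def u2_def)
  qed
  then show ?thesis using u3 e0 e3 by blast
qed

lemma glued_walk:
  fixes lo hi e :: "nat \<Rightarrow> int"
  assumes "0 < K"
    and "\<And>i. i < N \<Longrightarrow> lo i < hi i \<and> 3 * (hi i - lo i) \<le> int K \<and> 0 \<le> lo i \<and> hi i \<le> H"
    and "\<And>i. i < N \<Longrightarrow> lo i \<le> e i \<and> e i \<le> hi i \<and> lo i \<le> e (Suc i) \<and> e (Suc i) \<le> hi i"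
    and "\<And>i. i < N \<Longrightarrow> even (int K + e i + e (Suc i))"
    and "0 < N"
  shows "\<exists>v. (\<forall>s<N * K. \<bar>v (Suc s) - v s\<bar> = 1 \<and> lo (s div K) \<le> min (v s) (v (Suc s)) \<and> min (v s) (v (Suc s)) < hi (s div K))
    \<and> (\<forall>s\<le>N * K. 0 \<le> v s \<and> v s \<le> H)
    \<and> (\<forall>i<N. \<forall>j. lo i \<le> j \<and> j < hi i \<longrightarrow> (\<exists>s. s div K = i \<and> min (v s) (v (Suc s)) = j))"
proof -
  have "\<exists>w. i < N \<longrightarrow> lattice_walk (lo i) (hi i) K w \<and> w 0 = e i \<and> w K = e (Suc i) \<and>
    (\<forall>j. lo i \<le> j \<and> j < hi i \<longrightarrow> (\<exists>s<K. min (w s) (w (Suc s)) = j))" for i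
    using covering_walk[of "lo i" "e i" "hi i" "e (Suc i)" K] assms(2-4)[of i] by blast
  then obtain w where w: "\<And>i. i < N \<Longrightarrow> lattice_walk (lo i) (hi i) K (w i)"
    "\<And>i. i < N \<Longrightarrow> w i 0 = e i" "\<And>i. i < N \<Longrightarrow> w i K = e (Suc i)"
    "\<And>i j. i < N \<Longrightarrow> lo i \<le> j \<Longrightarrow> j < hi i \<Longrightarrow> \<exists>s<K. min (w i s) (w i (Suc s)) = j"
    by metis
  define v where "v s = (if s mod K = 0 then e (s div K) else w (s div K) (s mod K))" for s
  have v0: "v (i * K + t) = w i t" if "i < N" "t < K" for i t
    using that assms(1) w(2)[OF that(1)] by (auto simp: v_def)
  have v1: "v (i * K + t) = w i t" if "i < N" "t \<le> K" for i t
  proof (cases "t = K")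
    case True
    then have "i * K + t = Suc i * K" by simp
    then show ?thesis using True w(3)[OF that(1)] assms(1) by (simp only: v_def) simp
  qed (use that v0 in auto)
  have vS: "v s = w (s div K) (s mod K)" "v (Suc s) = w (s div K) (Suc (s mod K))"
    "s div K < N" "s mod K < K" if "s < N * K" for s
  proof -
    show i: "s div K < N" and r: "s mod K < K" using that assms(1) by (auto simp: less_mult_imp_div_less)
    show "v s = w (s div K) (s mod K)" using v1[OF i, of "s mod K"] r by simp
    show "v (Suc s) = w (s div K) (Suc (s mod K))" using v1[OF i, of "Suc (s mod K)"] r by simp
  qed
  have "\<bar>v (Suc s) - v s\<bar> = 1 \<and> lo (s div K) \<le> min (v s) (v (Suc s)) \<and> min (v s) (v (Suc s)) < hi (s div K)"
    if "s < N * K" for s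
  proof -
    note s = vS[OF that]
    have "\<bar>v (Suc s) - v s\<bar> = 1" "lo (s div K) \<le> v s" "v s \<le> hi (s div K)"
       "lo (s div K) \<le> v (Suc s)" "v (Suc s) \<le> hi (s div K)"
      using w(1)[OF s(3)] s(4) unfolding s(1,2) lattice_walk_def by simp_all
    then show ?thesis by linarith
  qed
  moreover have "0 \<le> v s \<and> v s \<le> H" if s: "s \<le> N * K" for s
  proof (cases "s = N * K")
    case True
    obtain p where p: "N = Suc p" using assms(5) by (cases N) auto
    have "v s = e N" using True assms(1) by (simp add: v_def)
    then show ?thesis using assms(2,3)[of p] p by fastforce
  next
    case False
    then have "s < N * K" using s by simp
    note s = vS[OF this]
    have "lo (s div K) \<le> v s" "v s \<le> hi (s div K)"
      using w(1)[OF s(3)] s(4) unfolding s(1) lattice_walk_def by simp_all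
    then show ?thesis using assms(2)[OF s(3)] by linarith
  qed
  moreover have "\<exists>s. s div K = i \<and> min (v s) (v (Suc s)) = j" if i: "i < N" and j: "lo i \<le> j" "j < hi i" for i j
  proof -
    obtain t where t: "t < K" "min (w i t) (w i (Suc t)) = j" using w(4)[OF i j] by blast
    have "v (i * K + t) = w i t" "v (Suc (i * K + t)) = w i (Suc t)"
      using v1[OF i, of t] v1[OF i, of "Suc t"] t(1) by auto
    then show ?thesis using t assms(1) by (intro exI[of _ "i * K + t"]) auto
  qed
  ultimately show ?thesis by blast
qed

text \<open>The half-open blocks indexed by \<open>L\<close> are disjoint and lie in the preimage of
  \<open>{p..q}\<close>, which has length \<open>q - p\<close>. Measure preservation of
  \<open>f\<close> enters the whole argument only through this inequality.\<close>

lemma count_le_length: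
  fixes f :: "real \<Rightarrow> real"
  assumes "f \<in> C_lambda" "0 < N" "L \<subseteq> {..<N}" "0 \<le> p" "p \<le> q" "q \<le> 1"
    and "\<And>i x. i \<in> L \<Longrightarrow> x \<in> {real i / N..(real i + 1) / N} \<Longrightarrow> f x \<in> {p..q}"
  shows "real (card L) / N \<le> q - p"
proof -
  define c where "c i = {real i / N..<(real i + 1) / N}" for i :: nat
  define S where "S = {x \<in> {0..1}. f x \<in> {p..q}}"
  have fin: "finite L" using assms(3) finite_subset by blast
  have sub: "(\<Union>i\<in>L. c i) \<subseteq> S"
  proof
    fix x assume "x \<in> (\<Union>i\<in>L. c i)"
    then obtain i where i: "i \<in> L" "x \<in> c i" by blast
    have "i < N" using i assms(3) by auto
    then have "real i + 1 \<le> N" by linarith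
    then have "(real i + 1) / N \<le> 1" using assms(2) by simp
    moreover have "0 \<le> real i / N" by simp
    moreover have "real i / N \<le> x" "x < (real i + 1) / N" using i(2) by (simp_all add: c_def)
    ultimately have "0 \<le> x" "x \<le> 1" by linarith+
    then have "x \<in> {0..1}" by simp
    moreover have "f x \<in> {p..q}" by (rule assms(7)[OF i(1)]) (use i(2) in \<open>auto simp: c_def\<close>)
    ultimately show "x \<in> S" by (simp add: S_def)
  qed
  have disj: "disjoint_family_on c L"
    unfolding disjoint_family_on_def
  proof (intro ballI impI)
    fix i j :: nat assume "i \<noteq> j"
    have less: "c i \<inter> c j = {}" if "i < j" for i j
    proof -
      have "(real i + 1) / N \<le> real j / N" using that by (intro divide_right_mono) auto
      then show ?thesis by (auto simp: c_def)
    qed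
    show "c i \<inter> c j = {}" using \<open>i \<noteq> j\<close> less[of i j] less[of j i] by (cases "i < j") auto
  qed
  have "continuous_on {0..1} f" using assms(1) by (simp add: C_lambda_def)
  then have "f \<in> borel_measurable (restrict_space borel {0..1})" by (rule borel_measurable_continuous_on_restrict)
  from measurable_sets_Collect[OF this, of "\<lambda>x. x \<in> {p..q}"]
  have "S \<in> sets (restrict_space borel {0..1})" by (simp add: S_def space_restrict_space)
  then have meas: "S \<in> sets borel" by (subst (asm) sets_restrict_space_iff) auto
  have "\<forall>A\<in>sets borel. A \<subseteq> {0..1} \<longrightarrow> emeasure lborel {x \<in> {0..1}. f x \<in> A} = emeasure lborel A"
    using assms(1) unfolding C_lambda_def by blast
  moreover have "{p..q} \<subseteq> {0..1}" using assms(4,6) by auto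
  moreover have "{p..q} \<in> sets borel" by simp
  ultimately have "emeasure lborel S = emeasure lborel {p..q}" unfolding S_def by blast
  then have S: "emeasure lborel S = ennreal (q - p)" using assms by simp
  have "ennreal (real (card L) / N) = (\<Sum>i\<in>L. emeasure lborel (c i))"
  proof -
    have "emeasure lborel (c i) = ennreal (1 / N)" for i
      by (simp add: c_def divide_right_mono add_divide_distrib)
    then have "(\<Sum>i\<in>L. emeasure lborel (c i)) = (\<Sum>i\<in>L. ennreal (1 / N))" by simp
    also have "\<dots> = ennreal (\<Sum>i\<in>L. 1 / N)" by (rule sum_ennreal) simp
    finally show ?thesis by simp
  qed
  also have "\<dots> = emeasure lborel (\<Union>i\<in>L. c i)"
    by (rule sum_emeasure[OF _ disj fin]) (auto simp: c_def)
  also have "\<dots> \<le> emeasure lborel S" by (rule emeasure_mono[OF sub]) (simp add: meas)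
  finally show ?thesis using assms(5) unfolding S by (simp add: ennreal_le_iff)
qed

text \<open>\<open>\<sigma> i\<close> is the rank of \<open>F i\<close>, ties being broken by the
  index. The bounds place it between the number of strictly smaller values and the number of values
  that are not larger.\<close>

lemma rank_permutation:
  fixes F :: "nat \<Rightarrow> real"
  obtains \<sigma> where "\<sigma> permutes {..<N}"
    "\<And>i. i < N \<Longrightarrow> \<sigma> i \<le> card {l\<in>{..<N}. F l \<le> F i}"
    "\<And>i. i < N \<Longrightarrow> N \<le> \<sigma> i + card {l\<in>{..<N}. F i \<le> F l}"
proof -
  define lt where "lt l i \<longleftrightarrow> F l < F i \<or> F l = F i \<and> l < i" for l i :: nat
  define \<sigma> where "\<sigma> i = (if i < N then card {l\<in>{..<N}. lt l i} else i)" for i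
  have mono: "\<sigma> l < \<sigma> i" if "l < N" "i < N" "lt l i" for l i
  proof -
    have "{k\<in>{..<N}. lt k l} \<subset> {k\<in>{..<N}. lt k i}"
      using that by (auto simp: lt_def)
    then show ?thesis using that by (simp add: \<sigma>_def psubset_card_mono)
  qed
  have total: "l = i \<or> lt l i \<or> lt i l" for l i by (auto simp: lt_def)
  have inj: "inj_on \<sigma> {..<N}"
  proof (rule inj_onI)
    fix l i assume "l \<in> {..<N}" "i \<in> {..<N}" "\<sigma> l = \<sigma> i"
    then show "l = i" using total[of l i] mono[of l i] mono[of i l] by auto
  qed
  have lN: "\<sigma> i < N" if "i < N" for i
  proof -
    have "{l\<in>{..<N}. lt l i} \<subset> {..<N}" using that by (auto simp: lt_def)
    from psubset_card_mono[OF _ this] show ?thesis using that by (simp add: \<sigma>_def)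
  qed
  have "\<sigma> ` {..<N} = {..<N}"
    by (rule endo_inj_surj) (use lN inj in auto)
  then have "bij_betw \<sigma> {..<N} {..<N}" using inj by (simp add: bij_betw_def)
  then have "\<sigma> permutes {..<N}" by (rule bij_imp_permutes) (simp add: \<sigma>_def)
  moreover have "\<sigma> i \<le> card {l\<in>{..<N}. F l \<le> F i}" if "i < N" for i
    using that unfolding \<sigma>_def by (auto simp: lt_def intro!: card_mono)
  moreover have "N \<le> \<sigma> i + card {l\<in>{..<N}. F i \<le> F l}" if "i < N" for i
  proof -
    have "{..<N} \<subseteq> {l\<in>{..<N}. lt l i} \<union> {l\<in>{..<N}. F i \<le> F l}" by (auto simp: lt_def)
    then have "card {..<N} \<le> card ({l\<in>{..<N}. lt l i} \<union> {l\<in>{..<N}. F i \<le> F l})" by (intro card_mono) auto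
    also have "\<dots> \<le> card {l\<in>{..<N}. lt l i} + card {l\<in>{..<N}. F i \<le> F l}" by (rule card_Un_le)
    finally show ?thesis using that by (simp add: \<sigma>_def)
  qed
  ultimately show ?thesis using that by blast
qed

text \<open>Each of the \<open>3 ^ M\<close> blocks has an odd number of steps, so the position at the start
of block \<open>i\<close> must have the parity of \<open>i\<close>.\<close>

lemma coarse_walk:
  fixes F :: "nat \<Rightarrow> real"
  assumes F01: "\<And>i. i \<le> 3 ^ M \<Longrightarrow> 0 \<le> F i \<and> F i \<le> 1"
    and Fmod: "\<And>i. i < 3 ^ M \<Longrightarrow> \<bar>F (Suc i) - F i\<bar> \<le> \<omega>" and "0 \<le> \<omega>"
  obtains v :: "nat \<Rightarrow> int" where
    "\<And>s. s < 3 ^ (2 * M + 1) \<Longrightarrow> \<bar>v (Suc s) - v s\<bar> = 1"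
    "\<And>s. s \<le> 3 ^ (2 * M + 1) \<Longrightarrow> 0 \<le> v s \<and> v s \<le> 3 ^ M"
    "\<And>s. s < 3 ^ (2 * M + 1) \<Longrightarrow>
       \<bar>3 ^ M * F (s div 3 ^ (M + 1)) - real_of_int (min (v s) (v (Suc s)))\<bar> \<le> 3 ^ M * \<omega> + 6"
    "\<And>i j. i < 3 ^ M \<Longrightarrow> j < 3 ^ M \<Longrightarrow> \<bar>3 ^ M * F i - real j\<bar> \<le> 3 ^ M * \<omega> + 2 \<Longrightarrow>
       \<exists>s. s div 3 ^ (M + 1) = i \<and> min (v s) (v (Suc s)) = int j"
proof -
  define N :: nat where "N = 3 ^ M"
  define H :: int where "H = 3 ^ M"
  have NH: "int N = H" "real N = 3 ^ M" "real_of_int H = 3 ^ M" by (simp_all add: N_def H_def)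
  have H1: "1 \<le> H" by (simp add: H_def)
  define y where "y i = \<lfloor>3 ^ M * F i\<rfloor>" for i
  \<comment> \<open>The 3 makes room for the rounding in \<open>y\<close> and for the parity shift
    by 1 in \<open>e\<close>: the next block start, up to \<open>D - 2\<close> away plus that shift,
    must still lie in the window of the current block.\<close>
  define D where "D = \<lceil>3 ^ M * \<omega>\<rceil> + 3"
  have D: "3 ^ M * \<omega> + 3 \<le> D" "D \<le> 3 ^ M * \<omega> + 4" unfolding D_def by linarith+
  have D3: "3 \<le> D" using assms(3) D_def by (simp add: ceiling_le_iff le_ceiling_iff) (smt (verit) zero_le_power mult_nonneg_nonneg)
  have y: "real_of_int (y i) \<le> 3 ^ M * F i" "3 ^ M * F i < real_of_int (y i) + 1" for i
    unfolding y_def by linarith+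
  have y0: "0 \<le> y i" and yH: "y i \<le> H" if "i \<le> N" for i
  proof -
    have "0 \<le> F i" "F i \<le> 1" using F01[of i] that by (auto simp: N_def)
    then have "0 \<le> 3 ^ M * F i" "3 ^ M * F i \<le> 3 ^ M" by auto
    then show "0 \<le> y i" "y i \<le> H" using y[of i] NH(3) by linarith+
  qed
  have ydiff: "\<bar>y (Suc i) - y i\<bar> \<le> D - 2" if "i < N" for i
  proof -
    have "\<bar>3 ^ M * F (Suc i) - 3 ^ M * F i\<bar> \<le> 3 ^ M * \<omega>"
      using mult_left_mono[OF Fmod[of i], of "3 ^ M"] that
      by (simp add: N_def abs_mult flip: right_diff_distrib)
    then have "\<bar>real_of_int (y (Suc i)) - real_of_int (y i)\<bar> \<le> 3 ^ M * \<omega> + 1"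
      using y[of i] y[of "Suc i"] by linarith
    then show ?thesis using D(1) by linarith
  qed
  define lo hi e where "lo i = max 0 (y i - D)" and "hi i = min H (y i + 1 + D)"
    and "e i = (if even (y i + int i) then y i else if y i = 0 then 1 else y i - 1)" for i
  have e: "even (e i + int i)" "y i - 1 \<le> e i" "e i \<le> y i + 1" "0 \<le> e i" "e i \<le> H" if "i \<le> N" for i
    using y0[OF that] yH[OF that] H1 by (auto simp: e_def)
  \<comment> \<open>A block has three times as many steps as the whole lattice has edges, so the
    length condition of \<open>glued_walk\<close> holds for every window inside
    \<open>{0..H}\<close>, however wide.\<close>
  have K: "int (3 ^ (M + 1)) = 3 * H" by (simp add: H_def)
  have odd: "odd (int (3 ^ (M + 1)))" by simp
  have "\<exists>v. (\<forall>s<N * 3 ^ (M + 1). \<bar>v (Suc s) - v s\<bar> = 1 \<and> lo (s div 3 ^ (M + 1)) \<le> min (v s) (v (Suc s)) \<and>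
        min (v s) (v (Suc s)) < hi (s div 3 ^ (M + 1)))
    \<and> (\<forall>s\<le>N * 3 ^ (M + 1). 0 \<le> v s \<and> v s \<le> H)
    \<and> (\<forall>i<N. \<forall>j. lo i \<le> j \<and> j < hi i \<longrightarrow> (\<exists>s. s div 3 ^ (M + 1) = i \<and> min (v s) (v (Suc s)) = j))"
  proof (rule glued_walk[where e = e])
    fix i assume i: "i < N"
    then have i': "i \<le> N" "Suc i \<le> N" by auto
    show "lo i < hi i \<and> 3 * (hi i - lo i) \<le> int (3 ^ (M + 1)) \<and> 0 \<le> lo i \<and> hi i \<le> H"
    proof -
      have "lo i < hi i" "0 \<le> lo i" "hi i \<le> H"
        using y0[OF i'(1)] yH[OF i'(1)] D3 H1 by (auto simp: lo_def hi_def)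
      moreover from this have "hi i - lo i \<le> H" by linarith
      ultimately show ?thesis unfolding K by auto
    qed
    show "lo i \<le> e i \<and> e i \<le> hi i \<and> lo i \<le> e (Suc i) \<and> e (Suc i) \<le> hi i"
      using e(2-5)[OF i'(1)] e(2-5)[OF i'(2)] ydiff[OF i] D3 by (auto simp: lo_def hi_def)
    show "even (int (3 ^ (M + 1)) + e i + e (Suc i))"
      using e(1)[OF i'(1)] e(1)[OF i'(2)] odd by auto
  qed (auto simp: N_def)
  moreover have NK: "N * 3 ^ (M + 1) = 3 ^ (2 * M + 1)"
  proof -
    have "N * 3 ^ (M + 1) = 3 ^ (M + (M + 1))" unfolding N_def by (rule power_add[symmetric])
    also have "M + (M + 1) = 2 * M + 1" by simp
    finally show ?thesis .
  qed
  ultimately obtain v :: "nat \<Rightarrow> int" where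
    v: "\<And>s. s < 3 ^ (2 * M + 1) \<Longrightarrow> \<bar>v (Suc s) - v s\<bar> = 1 \<and>
          lo (s div 3 ^ (M + 1)) \<le> min (v s) (v (Suc s)) \<and> min (v s) (v (Suc s)) < hi (s div 3 ^ (M + 1))"
    "\<And>s. s \<le> 3 ^ (2 * M + 1) \<Longrightarrow> 0 \<le> v s \<and> v s \<le> H"
    "\<And>i j. i < N \<Longrightarrow> lo i \<le> j \<Longrightarrow> j < hi i \<Longrightarrow> \<exists>s. s div 3 ^ (M + 1) = i \<and> min (v s) (v (Suc s)) = j"
    unfolding NK by blast
  show ?thesis
  proof (rule that[of v])
    fix s :: nat assume s: "s < 3 ^ (2 * M + 1)"
    show "\<bar>v (Suc s) - v s\<bar> = 1" using v(1)[OF s] by blast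
    define i where "i = s div 3 ^ (M + 1)"
    have "y i - D \<le> min (v s) (v (Suc s))" "min (v s) (v (Suc s)) \<le> y i + D"
      using v(1)[OF s] unfolding i_def[symmetric] lo_def hi_def by linarith+
    then have "real_of_int (y i) - real_of_int D \<le> real_of_int (min (v s) (v (Suc s)))"
      "real_of_int (min (v s) (v (Suc s))) \<le> real_of_int (y i) + real_of_int D" by linarith+
    then show "\<bar>3 ^ M * F (s div 3 ^ (M + 1)) - real_of_int (min (v s) (v (Suc s)))\<bar> \<le> 3 ^ M * \<omega> + 6"
      using y[of i] D(2) unfolding i_def[symmetric] by linarith
  next
    fix s :: nat assume "s \<le> 3 ^ (2 * M + 1)"
    then show "0 \<le> v s \<and> v s \<le> 3 ^ M" using v(2) by (simp add: H_def)
  next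
    fix i j :: nat assume i: "i < 3 ^ M" and j: "j < 3 ^ M" and near: "\<bar>3 ^ M * F i - real j\<bar> \<le> 3 ^ M * \<omega> + 2"
    have "real_of_int (y i) - real_of_int D \<le> real j" "real j < real_of_int (y i) + 1 + real_of_int D"
      using near y[of i] D(1) by linarith+
    then have "y i - D \<le> int j" "int j < y i + 1 + D" by linarith+
    moreover have "int j < H" using j unfolding NH(1)[symmetric] by (simp add: N_def)
    ultimately have "lo i \<le> int j" "int j < hi i" by (simp_all add: lo_def hi_def)
    then show "\<exists>s. s div 3 ^ (M + 1) = i \<and> min (v s) (v (Suc s)) = int j" using v(3)[of i "int j"] i by (simp add: N_def)
  qed
qed

section \<open>The transition graph of a length-preserving map on the grid\<close>

locale grid_modulus =
  fixes f :: "real \<Rightarrow> real" and N :: nat and \<omega> :: real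
  assumes f: "f \<in> C_lambda" and N: "0 < N"
    and fmod: "\<And>x y. x \<in> {0..1} \<Longrightarrow> y \<in> {0..1} \<Longrightarrow> \<bar>x - y\<bar> \<le> 1 / N \<Longrightarrow> \<bar>f x - f y\<bar> \<le> \<omega>"
begin

text \<open>\<open>N * \<omega>\<close> pays for the oscillation of \<open>f\<close> over one block;
  the additional 2 pays for rounding and for the extra blocks by which runs grow.\<close>

definition near :: "nat \<Rightarrow> nat \<Rightarrow> bool" where
  "near i j \<longleftrightarrow> i < N \<and> j < N \<and> \<bar>N * f (i / N) - j\<bar> \<le> N * \<omega> + 2"

lemma f01: "x \<in> {0..1} \<Longrightarrow> f x \<in> {0..1}"
  using f unfolding C_lambda_def by blast

lemma fcont: "continuous_on {0..1} f"
  using f unfolding C_lambda_def by blast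

lemma omega_nonneg: "0 \<le> \<omega>"
  using fmod[of 0 0] by auto

lemma grid01: "i \<le> N \<Longrightarrow> real i / N \<in> {0..1}"
  using N by simp

lemma block:
  assumes "x \<in> {real i / N .. (real i + 1) / N}" "i < N"
  shows "x \<in> {0..1}" "\<bar>f x - f (i / N)\<bar> \<le> \<omega>" "\<bar>N * f x - N * f (i / N)\<bar> \<le> N * \<omega>"
proof -
  have "real (Suc i) / N \<in> {0..1}" using assms by (intro grid01) simp
  then have "(real i + 1) / N \<le> 1" by (simp add: add.commute)
  moreover have "0 \<le> real i / N" by simp
  ultimately have "0 \<le> x" "x \<le> 1" using assms(1) unfolding atLeastAtMost_iff by linarith+
  then show x: "x \<in> {0..1}" by simp
  have "\<bar>x - i / N\<bar> \<le> 1 / N" using assms(1) by (simp add: add_divide_distrib)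
  then show *: "\<bar>f x - f (i / N)\<bar> \<le> \<omega>" using fmod[OF x grid01] assms by simp
  have "\<bar>N * f x - N * f (i / N)\<bar> = N * \<bar>f x - f (i / N)\<bar>"
    by (simp add: abs_mult flip: right_diff_distrib)
  then show "\<bar>N * f x - N * f (i / N)\<bar> \<le> N * \<omega>" using * by (simp add: mult_left_mono)
qed

lemma block_exists:
  assumes "a < b" "b \<le> N" "x \<in> {real a / N .. real b / N}"
  obtains i where "a \<le> i" "i < b" "x \<in> {real i / N .. (real i + 1) / N}"
proof (cases "x = b / N")
  case True
  have "x \<in> {real (b - 1) / N .. (real (b - 1) + 1) / N}"
    using assms True by (simp add: of_nat_diff divide_right_mono)
  then show ?thesis using that[of "b - 1"] assms by simp
next
  case False
  have "real a / N \<le> x" "x < real b / N" using assms(3) False by auto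
  then have x: "real a \<le> x * N" "x * N < real b"
    using N by (simp_all add: pos_divide_le_eq pos_less_divide_eq)
  define i where "i = nat \<lfloor>x * N\<rfloor>"
  have i: "real i \<le> x * N" "x * N < real i + 1" using x by (auto simp: i_def) 
  have "real a < real i + 1" "real i < real b" using x i by linarith+
  then have "a \<le> i" "i < b" by linarith+
  moreover have "x \<in> {real i / N .. (real i + 1) / N}" using i N by (simp add: field_simps)
  ultimately show ?thesis using that by blast
qed

lemma near_loop: "\<exists>i<N. near i i"
proof -
  have "\<exists>x\<in>{0..1}. f x = x"
  proof -
    have c: "continuous_on {0..1} (\<lambda>x. f x - x)" by (intro continuous_intros fcont)
    have "\<exists>x\<ge>0. x \<le> 1 \<and> f x - x = 0"
      by (rule IVT2'[of "\<lambda>x. f x - x" 1 0 0]) (use f01[of 0] f01[of 1] c in auto)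
    then show ?thesis by auto
  qed
  then obtain x where x: "x \<in> {0..1}" "f x = x" by blast
  obtain i where i: "i < N" "x \<in> {real i / N .. (real i + 1) / N}"
    using block_exists[of 0 N x] x N by auto
  have "real i \<le> N * x" "N * x \<le> real i + 1" using i(2) N by (simp_all add: field_simps)
  then have "\<bar>N * f (i / N) - i\<bar> \<le> N * \<omega> + 2"
    using block(3)[OF i(2,1)] unfolding x(2) by linarith
  then show ?thesis using i(1) by (auto simp: near_def)
qed

text \<open>As \<open>f\<close> preserves Lebesgue measure, the image of an interval is at least as long as the interval;
the slack in \<open>near\<close> makes the covered interval strictly longer.\<close>

lemma near_grow:
  assumes ab: "a < b" "b \<le> N"
  shows "\<exists>a' b'. b' \<le> N \<and> a' + min N (Suc (b - a)) \<le> b' \<and>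
    (\<forall>j. a' \<le> j \<and> j < b' \<longrightarrow> (\<exists>i. a \<le> i \<and> i < b \<and> near i j))"
proof -
  let ?S = "{real a / N .. real b / N}"
  have S01: "?S \<subseteq> {0..1}" using grid01[of a] grid01[of b] ab by auto
  have ne: "real a / N \<le> real b / N" using ab by (simp add: divide_right_mono)
  have c: "continuous_on ?S f" using fcont S01 by (rule continuous_on_subset)
  obtain p q where img: "f ` ?S = {p..q}" "p \<le> q"
    using continuous_image_closed_interval[OF ne c] by blast
  have "{p..q} \<subseteq> {0..1}" unfolding img(1)[symmetric] using f01 S01 by blast
  then have pq: "0 \<le> p" "q \<le> 1" using img(2) by auto
  have "real (card {a..<b}) / N \<le> q - p"
  proof (rule count_le_length[OF f N _ pq(1) img(2) pq(2)])
    show "{a..<b} \<subseteq> {..<N}" using ab by auto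
    fix i x assume i: "i \<in> {a..<b}" and x: "x \<in> {real i / N..(real i + 1) / N}"
    have "real a / N \<le> real i / N" "(real i + 1) / N \<le> real b / N"
      using i by (auto intro!: divide_right_mono)
    then have "x \<in> ?S" using x by auto
    then show "f x \<in> {p..q}" using img by blast
  qed
  then have len: "real b - real a \<le> N * q - N * p" using ab N by (simp add: field_simps of_nat_diff)
  \<comment> \<open>The rounded image gets one more block on each side. If one side is cut off at
    the end of the interval, the other still provides the gain; if both are, all \<open>N\<close>
    blocks are covered.\<close>
  define a' b' where "a' = nat (\<lfloor>N * p\<rfloor> - 1)" and "b' = nat (min (int N) (\<lfloor>N * q\<rfloor> + 2))"
  have Np: "0 \<le> N * p" "N * q \<le> N" using pq N by auto

  have 1: "b' \<le> N" by (simp add: b'_def)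
  have 2: "a' + min N (Suc (b - a)) \<le> b'"
  proof -
    have "0 \<le> N * q" using pq img(2) N by auto
    then have i: "int b - int a \<le> \<lfloor>N * q\<rfloor> - \<lfloor>N * p\<rfloor> + 1" "int b - int a \<le> int N - \<lfloor>N * p\<rfloor>"
      "int b - int a \<le> \<lfloor>N * q\<rfloor>"  "0 \<le> \<lfloor>N * p\<rfloor>" "0 \<le> \<lfloor>N * q\<rfloor>"
      using len Np by linarith+
    have "int (Suc (b - a)) = int b - int a + 1" using ab by (simp add: of_nat_diff)
    then have "int a' + min (int N) (int (Suc (b - a))) \<le> int b'"
      using i ab by (auto simp: a'_def b'_def)
    then show ?thesis by linarith
  qed
  have 3: "\<exists>i. a \<le> i \<and> i < b \<and> near i j" if j: "a' \<le> j" "j < b'" for j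
  proof -
    have jr: "N * p - 2 \<le> real j" "real j \<le> N * q + 1" "j < N"
      using j by (auto simp: a'_def b'_def) linarith+
    \<comment> \<open>The point of the image closest to \<open>j / N\<close>; a preimage of it
      locates the block \<open>i\<close>.\<close>
    define t where "t = max p (min q (j / N))"
    have tpq: "t \<in> {p..q}" using img(2) by (auto simp: t_def)
    have t: "\<bar>N * t - j\<bar> \<le> 2"
    proof -
      have "N * t = max (N * p) (min (N * q) j)" using N by (simp add: t_def max_mult_distrib_left min_mult_distrib_left)
      moreover have "N * p \<le> N * q" using img(2) by (simp add: mult_left_mono)
      ultimately show ?thesis using jr by linarith
    qed
    obtain x where x: "x \<in> ?S" "f x = t" using tpq img(1) by (metis imageE)
    obtain i where i: "a \<le> i" "i < b" "x \<in> {real i / N .. (real i + 1) / N}" using block_exists[OF ab x(1)] .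
    have iN: "i < N" using i ab by simp
    have "\<bar>N * f (i / N) - j\<bar> \<le> N * \<omega> + 2"
      using block(3)[OF i(3) iN] t unfolding x(2) by linarith
    then show ?thesis using i iN jr by (auto simp: near_def)
  qed
  show ?thesis using 1 2 3 by blast
qed

text \<open>Blocks with \<open>F l \<le> F i\<close> are mapped below \<open>F i + \<omega>\<close>,
  so \<open>count_le_length\<close> bounds their number by \<open>N * (F i + \<omega>)\<close>;
  blocks with \<open>F i \<le> F l\<close> are counted symmetrically. The rank of \<open>F i\<close>
  is therefore within \<open>N * \<omega>\<close> of \<open>N * F i\<close>.\<close>

lemma near_permutation: "\<exists>\<sigma>. \<sigma> permutes {..<N} \<and> (\<forall>i<N. near i (\<sigma> i))"
proof -
  define F where "F i = f (real i / N)" for i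
  obtain \<sigma> where \<sigma>: "\<sigma> permutes {..<N}"
    "\<And>i. i < N \<Longrightarrow> \<sigma> i \<le> card {l\<in>{..<N}. F l \<le> F i}"
    "\<And>i. i < N \<Longrightarrow> N \<le> \<sigma> i + card {l\<in>{..<N}. F i \<le> F l}"
    using rank_permutation[where F = F and N = N] by blast
  have "near i (\<sigma> i)" if i: "i < N" for i
  proof -
    have Fi: "0 \<le> F i" "F i \<le> 1" using f01[OF grid01[of i]] i by (auto simp: F_def)
    have "real (card {l\<in>{..<N}. F l \<le> F i}) / N \<le> min 1 (F i + \<omega>) - 0"
    proof (rule count_le_length[OF f N])
      fix l x assume l: "l \<in> {l\<in>{..<N}. F l \<le> F i}" and x: "x \<in> {real l / N..(real l + 1) / N}"
      then show "f x \<in> {0..min 1 (F i + \<omega>)}"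
        using block(1,2)[OF x] f01[of x] by (auto simp: F_def)
    qed (use Fi omega_nonneg in auto)
    then have "real (card {l\<in>{..<N}. F l \<le> F i}) \<le> N * (F i + \<omega>)"
      using N by (simp add: pos_divide_le_eq mult.commute)
    then have up: "real (\<sigma> i) \<le> N * F i + N * \<omega>"
      using \<sigma>(2)[OF i] by (simp add: distrib_left)
    have "real (card {l\<in>{..<N}. F i \<le> F l}) / N \<le> 1 - max 0 (F i - \<omega>)"
    proof (rule count_le_length[OF f N])
      fix l x assume l: "l \<in> {l\<in>{..<N}. F i \<le> F l}" and x: "x \<in> {real l / N..(real l + 1) / N}"
      then show "f x \<in> {max 0 (F i - \<omega>)..1}"
        using block(1,2)[OF x] f01[of x] by (auto simp: F_def)
    qed (use Fi omega_nonneg in auto)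
    then have "real (card {l\<in>{..<N}. F i \<le> F l}) / N \<le> 1 - F i + \<omega>" by linarith
    then have "real (card {l\<in>{..<N}. F i \<le> F l}) \<le> N * (1 - F i + \<omega>)"
      using N by (simp add: pos_divide_le_eq mult.commute)
    then have "real (card {l\<in>{..<N}. F i \<le> F l}) \<le> N - N * F i + N * \<omega>"
      by (simp add: algebra_simps)
    then have lo: "N * F i - N * \<omega> \<le> real (\<sigma> i)" using \<sigma>(3)[OF i] by linarith
    have "\<sigma> i < N" using permutes_in_image[OF \<sigma>(1), of i] i by simp
    then show ?thesis using up lo i unfolding near_def F_def by (auto simp: abs_le_iff)
  qed
  then show ?thesis using \<sigma>(1) by blast
qed

end

section \<open>Density\<close>

theorem theorem1p2:
  shows "\<forall>f \<in> C_lambda. \<forall>\<epsilon> > 0. \<exists>g \<in> C_lambda.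
           leo g \<and> emeasure lborel (Per g) = 1 \<and>
           (\<forall>k \<ge> 1. emeasure lborel (Per_k g k) > 0) \<and>
           unif_dist f g < \<epsilon>"
proof (intro ballI allI impI)
  fix f :: "real \<Rightarrow> real" and \<epsilon> :: real
  assume f: "f \<in> C_lambda" and \<epsilon>: "0 < \<epsilon>"
  \<comment> \<open>Error budget: \<open>\<omega>\<close> for replacing \<open>x\<close> by
    \<open>y\<close> in \<open>f\<close>, \<open>2 * \<omega> + 7 / N\<close> between
    \<open>f\<close> and the walk map, \<open>2 / N\<close> between the walk map and its conjugate.
    With \<open>9 / N < \<omega>\<close> the total stays below
    \<open>4 * \<omega> = \<epsilon> / 2\<close>.\<close>
  define \<omega> where "\<omega> = \<epsilon> / 8"
  have \<omega>: "0 < \<omega>" using \<epsilon> by (simp add: \<omega>_def)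
  have "uniformly_continuous_on {0..1} f"
    using f unfolding C_lambda_def by (blast intro: compact_uniformly_continuous compact_Icc)
  then obtain \<delta> where \<delta>: "0 < \<delta>"
    "\<And>x y. x \<in> {0..1} \<Longrightarrow> y \<in> {0..1} \<Longrightarrow> dist y x < \<delta> \<Longrightarrow> dist (f y) (f x) < \<omega>"
    unfolding uniformly_continuous_on_def using \<omega> by metis
  \<comment> \<open>\<open>72 = 9 * 8\<close> yields \<open>9 / N < \<omega>\<close>, and
    \<open>2 / \<delta>\<close> reflects that the conjugacy displaces points by up to
    \<open>2 / N\<close>.\<close>
  obtain M :: nat where M: "72 / \<epsilon> + 2 / \<delta> < 3 ^ M"
    using real_arch_pow[of 3 "72 / \<epsilon> + 2 / \<delta>"] by auto
  define N :: nat where "N = 3 ^ M"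
  have N: "0 < N" "real N = 3 ^ M" by (simp_all add: N_def)
  have "0 < 72 / \<epsilon>" "0 < 2 / \<delta>" using \<epsilon> \<delta>(1) by auto
  then have "72 / \<epsilon> < N" "2 / \<delta> < N" using M N(2) by linarith+
  then have N\<epsilon>: "9 / N < \<omega>" and N\<delta>: "2 / N < \<delta>"
    using \<epsilon> \<delta>(1) N(1) by (simp_all add: \<omega>_def field_simps)
  have fmod2: "\<bar>f x - f y\<bar> \<le> \<omega>" if "x \<in> {0..1}" "y \<in> {0..1}" "\<bar>x - y\<bar> \<le> 2 / N" for x y
    using \<delta>(2)[OF that(2,1)] that(3) N\<delta> by (simp add: dist_real_def)
  have fmod: "\<bar>f x - f y\<bar> \<le> \<omega>" if "x \<in> {0..1}" "y \<in> {0..1}" "\<bar>x - y\<bar> \<le> 1 / N" for x y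
  proof (rule fmod2[OF that(1,2)])
    have "1 / N \<le> 2 / N" by (simp add: divide_right_mono)
    then show "\<bar>x - y\<bar> \<le> 2 / N" using that(3) by linarith
  qed
  interpret D: grid_modulus f N \<omega>
    by unfold_locales (use f N(1) fmod in auto)
  define F where "F i = f (real i / N)" for i
  obtain v where v:
    "\<And>s. s < 3 ^ (2 * M + 1) \<Longrightarrow> \<bar>v (Suc s) - v s\<bar> = 1"
    "\<And>s. s \<le> 3 ^ (2 * M + 1) \<Longrightarrow> 0 \<le> v s \<and> v s \<le> 3 ^ M"
    "\<And>s. s < 3 ^ (2 * M + 1) \<Longrightarrow>
       \<bar>3 ^ M * F (s div 3 ^ (M + 1)) - real_of_int (min (v s) (v (Suc s)))\<bar> \<le> 3 ^ M * \<omega> + 6"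
    "\<And>i j. i < 3 ^ M \<Longrightarrow> j < 3 ^ M \<Longrightarrow> \<bar>3 ^ M * F i - real j\<bar> \<le> 3 ^ M * \<omega> + 2 \<Longrightarrow>
       \<exists>s. s div 3 ^ (M + 1) = i \<and> min (v s) (v (Suc s)) = int j"
  proof (rule coarse_walk)
    fix i :: nat
    show "0 \<le> F i \<and> F i \<le> 1" if "i \<le> 3 ^ M"
      using D.f01[OF D.grid01[of i]] that unfolding F_def by (simp add: N_def)
    show "\<bar>F (Suc i) - F i\<bar> \<le> \<omega>" if "i < 3 ^ M"
    proof -
      have "i \<le> N" "Suc i \<le> N" using that by (auto simp: N_def)
      moreover have "\<bar>real (Suc i) / N - real i / N\<bar> \<le> 1 / N" by (simp flip: diff_divide_distrib)
      ultimately show ?thesis unfolding F_def by (intro fmod D.grid01)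
    qed
  qed (use \<omega> in auto)
  obtain Y where Y: "unit_ramp Y"
    "\<And>k u. k < 9 \<Longrightarrow> u \<in> {0..1} \<Longrightarrow>
       Y ((real k + u) / 9) = (real_of_int (zigzag k) + real_of_int (zigzag (Suc k) - zigzag k) * Y u) / 3"
    using peano_ramp by blast
  interpret W: zigzag_walk Y M v
    by unfold_locales (use Y v(1,2) in blast)+
  obtain \<sigma> where \<sigma>: "\<sigma> permutes {..<N}" "\<And>i. i < N \<Longrightarrow> D.near i (\<sigma> i)"
    using D.near_permutation by blast
  interpret S: spreading W.g M "D.near" \<sigma>
  proof
    fix i j assume near: "D.near i j" and i: "i < 3 ^ M"
    have "j < 3 ^ M" "\<bar>3 ^ M * F i - real j\<bar> \<le> 3 ^ M * \<omega> + 2"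
      using near unfolding D.near_def N(2) F_def by (simp_all add: N_def)
    from v(4)[OF i this] obtain s where s: "s div 3 ^ (M + 1) = i" "min (v s) (v (Suc s)) = int j"
      by blast
    then have d: "desc (2 * M + 1) s M i" by (simp add: desc_def)
    then have "s < 3 ^ (2 * M + 1)" using desc_bound i by blast
    from W.edge_image[OF this] d s(2)
    show "\<exists>s. desc (2 * M + 1) s M i \<and> W.g ` cell (2 * M + 1) s = cell M j" by auto
  next
    fix a b :: nat assume "a < b" "b \<le> 3 ^ M"
    then show "\<exists>a' b'. b' \<le> 3 ^ M \<and> a' + min (3 ^ M) (Suc (b - a)) \<le> b' \<and>
       (\<forall>j. a' \<le> j \<and> j < b' \<longrightarrow> (\<exists>i. a \<le> i \<and> i < b \<and> D.near i j))"
      using D.near_grow[of a b] unfolding N_def by blast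
  next
    show "\<exists>i<3 ^ M. D.near i i" using D.near_loop unfolding N_def by blast
    show "\<sigma> permutes {..<3 ^ M}" "\<And>i. i < 3 ^ M \<Longrightarrow> D.near i (\<sigma> i)"
      using \<sigma> unfolding N_def by blast+
  qed
  interpret U: unit_map W.g
    by unfold_locales (rule W.g_cont, rule S.maps_unit)
  have "permutation \<sigma>" using \<sigma>(1) by (auto simp: permutation_permutes)
  then obtain q where q: "\<sigma> ^^ q = id" "0 < q" using permutation_is_nilpotent by blast
  obtain G where G: "G \<in> C_lambda" "leo G" "emeasure lborel (Per G) = 1"
    "\<And>k. k \<ge> 1 \<Longrightarrow> 0 < emeasure lborel (Per_k G k)"
    "\<And>x. x \<in> {0..1} \<Longrightarrow> \<exists>y\<in>{0..1}. \<bar>x - y\<bar> \<le> 2 / 3 ^ M \<and> \<bar>G x - W.g y\<bar> \<le> 2 / 3 ^ M"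
    using U.lambda_conjugate[OF S.family_dense S.family_Per S.perm(1) q(2) S.family_perm[OF q] S.leo_g] by blast
  \<comment> \<open>One \<open>\<omega>\<close> is the oscillation of \<open>f\<close> on the block,
    the other the half-width of the walk's window; 7 is the 6 of \<open>coarse_walk\<close> plus one
    cell length.\<close>
  have gf: "\<bar>W.g y - f y\<bar> \<le> 2 * \<omega> + 7 / N" if y: "y \<in> {0..1}" for y
  proof -
    obtain s where s: "s < 3 ^ (2 * M + 1)" "y \<in> cell (2 * M + 1) s" using cell_cover[OF y] .
    define i where "i = s div 3 ^ (M + 1)"
    define j where "j = min (v s) (v (Suc s))"
    have d: "desc (2 * M + 1) s M i" by (simp add: desc_def i_def)
    have iN: "i < N" using desc_bound[OF d] s(1) by (simp add: N_def)
    have "y \<in> {real i / N .. (real i + 1) / N}" using desc_cell[OF d] s(2) unfolding cell_def N(2) by blast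
    from D.block(3)[OF this iN] have fy: "\<bar>N * f y - N * F i\<bar> \<le> N * \<omega>" by (simp add: F_def)
    have Fj: "\<bar>N * F i - real_of_int j\<bar> \<le> N * \<omega> + 6" using v(3)[OF s(1)] by (simp add: N(2) i_def j_def)
    have "0 \<le> j" using v(2)[of s] v(2)[of "Suc s"] s(1) by (simp add: j_def)
    moreover have "W.g y \<in> cell M (nat j)" using W.edge_image[OF s(1)] s(2) by (auto simp: j_def)
    ultimately have "real_of_int j / N \<le> W.g y" "W.g y \<le> (real_of_int j + 1) / N"
      by (simp_all add: cell_def N(2))
    then have gj: "real_of_int j \<le> N * W.g y" "N * W.g y \<le> real_of_int j + 1"
      using N(1) by (simp_all add: field_simps)
    have "\<bar>N * W.g y - N * f y\<bar> \<le> 2 * (N * \<omega>) + 7" using gj Fj fy by linarith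
    then have "N * \<bar>W.g y - f y\<bar> \<le> N * (2 * \<omega> + 7 / N)"
      using N(1) by (simp add: abs_mult distrib_left flip: right_diff_distrib)
    then show ?thesis using N(1) by simp
  qed
  have close: "\<bar>f x - G x\<bar> \<le> \<epsilon> / 2" if x: "x \<in> {0..1}" for x
  proof -
    obtain y where y: "y \<in> {0..1}" "\<bar>x - y\<bar> \<le> 2 / N" "\<bar>G x - W.g y\<bar> \<le> 2 / N"
      using G(5)[OF x] unfolding N(2)[symmetric] by blast
    have "\<bar>f x - G x\<bar> \<le> 3 * \<omega> + (7 / N + 2 / N)" using fmod2[OF x y(1,2)] gf[OF y(1)] y(3) by linarith
    also have "7 / N + 2 / N = 9 / N" by (simp flip: add_divide_distrib)
    also have "3 * \<omega> + 9 / N \<le> \<epsilon> / 2" using N\<epsilon> by (simp add: \<omega>_def)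
    finally show ?thesis by simp
  qed
  have "unif_dist f G \<le> \<epsilon> / 2"
    unfolding unif_dist_def by (rule cSUP_least) (use close in auto)
  then have "unif_dist f G < \<epsilon>" using \<epsilon> by linarith
  then show "\<exists>g \<in> C_lambda. leo g \<and> emeasure lborel (Per g) = 1 \<and>
      (\<forall>k \<ge> 1. emeasure lborel (Per_k g k) > 0) \<and> unif_dist f g < \<epsilon>"
    using G by blast
qed

end
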